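(* Let $k$ be an algebraically closed field of characteristic $0$, let $n>2$, and let $v$ be a rank-one discrete valuation of $K_n=k((X_1,\ldots,X_n))$ (the quotient field of $k[[X_1,\ldots,X_n]]$) over $k$, with value group $\mathbb{Z}$, whose center in $k[[X_1,\ldots,X_n]]$ is the maximal ideal $(X_1,\ldots,X_n)$. Let the integer $m$ and the elements $u_2$, $u_{i,j}$, $u_i$ be those produced by the construction procedure described in the context. Then the residue field of $v$ is $$\Delta_n=k\left(u_2,\{u_{3,j}\}_{j=1}^{s_3},u_3,\ldots,\{u_{m,j}\}_{j=1}^{s_m},u_m\right)\left(\{u_{m+1,j}\}_{j\ge1},\ldots,\{u_{n,j}\}_{j\ge1}\right),$$ and the transcendence degree of $\Delta_n$ over $k$ is $m-1$.
   Context: Notation. $\widehat K_n$ is the completion of $K_n$ with respect to $v$, and $\widehat v$ is the extension of $v$ to $\widehat K_n$; $\widehat R_v$, $\widehat{\mathfrak m}_v$, $\Delta_{\widehat v}$ are the valuation ring, maximal ideal and residue field of $\widehat v$. The residue field $\Delta_v$ of $v$ is isomorphic to $\Delta_{\widehat v}$. A $k$-section is a $k$-homomorphism $\sigma:\Delta_{\widehat v}\to\widehat R_v$ that is a section of the natural homomorphism $\widehat R_v\to\Delta_{\widehat v}$; $\Delta_{\widehat v}$ is identified with its image $\sigma(\Delta_{\widehat v})$, in which the elements $u_2,u_{i,j},u_i$ below lie. Transformations. A monoidal transformation is $k[[X_1,\ldots,X_n]]\to k[[Y_1,\ldots,Y_n]]$, $X_1\mapsto Y_1$, $X_2\mapsto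 Y_1Y_2$, $X_i\mapsto Y_i$ ($i\ge3$), where $v(X_2)>v(X_1)$. A change of coordinates is $k[[X_1,\ldots,X_n]]\to L[[Y_1,\ldots,Y_n]]$, $X_1\mapsto Y_1$, $X_i\mapsto Y_i+c_iY_1$ ($i\ge2$), where $c_i\in\widehat R_v\setminus\widehat{\mathfrak m}_v$ and $L$ is an extension field of $k$. A transformation is a monoidal transformation, a change of coordinates, an interchange of variables, or a finite composition of these. The new variables lie in $\widehat R_v$. By a Euclidean algorithm on the values, finitely many monoidal transformations (with interchanges of variables) make all variables have the same value, the gcd of their values; call this "equalizing". First transcendental residue. Equalize to get $Y_1,\ldots,Y_n$ of common value $\alpha$. For a pair $(i,j)$, if the residue of $Y_i/Y_j$ is in $k$, equal to that of $a_{i,1}\in k$, pass to $Y_i-a_{i,1}Y_j$; if its value is $r\alpha$ and the residue of its quotient by $Y_j^{r}$ is again in $k$, equal to that of $a_{i,r}$, subtract $a_{i,r}Y_j^{r}$; and so on. This stops for some pair; after reordering, for $Y_2$ with respect to $Y_1$. This gives $Z_2=Y_2-\sum_{l=1}^{s_2}a_{2,l}Y_1^l$ with $a_{2,l}\in k$, such that either (a) $\widehat v(Z_2)=r\,\widehat v(Y_1)$ and the residue of $Z_2/Y_1^r$ is not in $k$, or (b) $\widehat v(Y_1)$ does not divide $\widehat v(Z_2)$. In case (a) replace $Y_2$ by $Z_2$ and equalize; in case (b) replace $Y_2$ by $Z_2$ and start again. After finitely many steps one has $Y_1,\ldots,Y_n$ of common value $\alpha$ such that the residue of $Y_2/Y_1$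 is not in $k$, hence is transcendental over $k$. The section and $\Delta_2$. Put $u_2=Y_2/Y_1$, let $\sigma_2:k(Y_2/Y_1+\widehat{\mathfrak m}_v)\to k(Y_2/Y_1)$ send the residue of $Y_2/Y_1$ to $u_2$, and let $\sigma$ be a $k$-section extending $\sigma_2$ (one exists). Put $\Delta_2=k(u_2)$ (identified by $\sigma_2$ with $k(Y_2/Y_1+\widehat{\mathfrak m}_v)$). The remaining variables. For $i=3,\ldots,n$, with $\Delta_{i-1}\subset\sigma(\Delta_{\widehat v})$ constructed, let $u_{i,1}$ be the image by $\sigma$ of the residue of $Y_i/Y_1$. If it is algebraic over $\Delta_{i-1}$, pass to $Y_i-u_{i,1}Y_1$, of value $>\alpha$. If this value is $r\alpha$, let $u_{i,r}$ be the image by $\sigma$ of the residue of $(Y_i-u_{i,1}Y_1)/Y_1^r$ (the coefficients $u_{i,j}$ with $1<j<r$ being $0$). If it is algebraic over $\Delta_{i-1}$, pass to $Y_i-u_{i,1}Y_1-u_{i,r}Y_1^r$, and so on. One of three situations occurs. (1) After finitely many steps, with all coefficients algebraic over $\Delta_{i-1}$, a value not divisible by $\alpha$ is reached. Then replace $Y_i$ by $Y_i-\sum_j u_{i,j}Y_1^j$ (the finite sum of the terms found), equalize, and begin the whole procedure again. The common value decreases each time, so after finitely many transformations it is minimal, in fact equal to $1$ (the value group being $\mathbb{Z}$), and this situation no longer occurs for any variable; one assumes from then on that this has been reached. (2) After finitely many algebraic coefficients, $Z_i=Y_i-\sum_{j=1}^{s_i}u_{i,j}Y_1^j$ is such that $u_i=\sigma(Z_i/Y_1^{\widehat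 v(Z_i)}+\widehat{\mathfrak m}_v)$ is transcendental over $\Delta_{i-1}$. Then $\Delta_i=\Delta_{i-1}(\{u_{i,j}\}_{j=1}^{s_i},u_i)$; monoidal transformations replace $Z_i$ by an element, again called $Y_i$, of the same value as $Y_1$, so that the residue of the new $Y_i/Y_1$ is transcendental over $\Delta_{i-1}$. (3) All the $u_{i,j}$, $j\ge1$, are algebraic over $\Delta_{i-1}$. Then $\Delta_i=\Delta_{i-1}(\{u_{i,j}\}_{j\ge1})$, an algebraic extension of $\Delta_{i-1}$. The variables are reordered, if necessary, so that the first $m$ elements give all the transcendental residues: the residue of $Y_i/Y_1$ (for the final $Y_i$) is transcendental over $\Delta_{i-1}$ for $i=2,\ldots,m$ (situation (2) for $i=3,\ldots,m$), and situation (3) occurs for $i=m+1,\ldots,n$, each extension $\Delta_m\subset\Delta_m(\{u_{i,j}\}_{j\ge1})$, $i=m+1,\ldots,n$, being algebraic.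
   Formalization: The section σ is also required to send the residue of each Z_i/Y_1^r in situation (2) to Z_i/Y_1^r itself, and Δ_n also contains the images by σ of the residues of the coefficients u_{i,j} found in rounds ended by situation (1); the claim fails without these. *)

theory Defs
  imports
    "HOL-Computational_Algebra.Computational_Algebra"
    "HOL-Library.Poly_Mapping"
begin

section \<open>Formal power series in finitely many variables\<close>

text \<open>
  Variables are indexed by a finite type \<open>'n\<close>, monomials are exponent vectors
  \<open>'n \<Rightarrow> nat\<close>; these carry the componentwise order, so that \<open>{..m}\<close> is the
  finite set of divisors of the monomial \<open>m\<close>.
\<close>

typedef ('a, 'n) mps = "UNIV :: (('n \<Rightarrow> nat) \<Rightarrow> 'a) set"
  morphisms mps_coeff Abs_mps ..

setup_lifting type_definition_mps

lemma mps_eq_iff: "f = g \<longleftrightarrow> (\<forall>m. mps_coeff f m = mps_coeff g m)"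
  by (auto simp: mps_coeff_inject[symmetric])

lemma finite_atMost_monomial [simp]: "finite {..m}"
  for m :: "'n::finite \<Rightarrow> nat"
proof -
  have "{..m} = (\<Pi>\<^sub>E i\<in>UNIV. {..m i})"
    by (auto simp: le_fun_def PiE_def Pi_def)
  thus ?thesis by (simp add: finite_PiE)
qed

instantiation mps :: (comm_ring_1, finite) comm_ring_1
begin

lift_definition zero_mps :: "('a, 'b) mps" is "\<lambda>_. 0" .
lift_definition one_mps :: "('a, 'b) mps" is "\<lambda>m. if m = (\<lambda>_. 0) then 1 else 0" .
lift_definition plus_mps :: "('a, 'b) mps \<Rightarrow> ('a, 'b) mps \<Rightarrow> ('a, 'b) mps"
  is "\<lambda>f g m. f m + g m" .
lift_definition minus_mps :: "('a, 'b) mps \<Rightarrow> ('a, 'b) mps \<Rightarrow> ('a, 'b) mps"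
  is "\<lambda>f g m. f m - g m" .
lift_definition uminus_mps :: "('a, 'b) mps \<Rightarrow> ('a, 'b) mps"
  is "\<lambda>f m. - f m" .
lift_definition times_mps :: "('a, 'b) mps \<Rightarrow> ('a, 'b) mps \<Rightarrow> ('a, 'b) mps"
  is "\<lambda>f g m. \<Sum>a\<in>{..m}. f a * g (\<lambda>i. m i - a i)" .

instance
proof
  fix f g h :: "('a, 'b) mps"
  show "f + g + h = f + (g + h)" by transfer (simp add: add.assoc)
  show "f + g = g + f" by transfer (simp add: add.commute)
  show "0 + f = f" by transfer simp
  show "- f + f = 0" by transfer simp
  show "f - g = f + - g" by transfer simp
  show "(0::('a, 'b) mps) \<noteq> 1" by transfer (auto simp: fun_eq_iff)
  show "(f + g) * h = f * h + g * h"
    by transfer (simp add: distrib_right sum.distrib)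
  show "f * g = g * f"
  proof (transfer, rule ext)
    fix f g :: "('b \<Rightarrow> nat) \<Rightarrow> 'a" and m :: "'b \<Rightarrow> nat"
    show "(\<Sum>a\<in>{..m}. f a * g (\<lambda>i. m i - a i)) = (\<Sum>a\<in>{..m}. g a * f (\<lambda>i. m i - a i))"
      by (rule sum.reindex_bij_witness[where i = "\<lambda>a i. m i - a i" and j = "\<lambda>a i. m i - a i"])
         (auto simp: le_fun_def fun_eq_iff mult.commute)
  qed
  show "1 * f = f"
  proof (transfer, rule ext)
    fix f :: "('b \<Rightarrow> nat) \<Rightarrow> 'a" and m :: "'b \<Rightarrow> nat"
    have "(\<Sum>a\<in>{..m}. (if a = (\<lambda>_. 0) then 1 else 0) * f (\<lambda>i. m i - a i))
        = (\<Sum>a\<in>{..m}. if a = (\<lambda>_. 0) then f (\<lambda>i. m i - a i) else 0)"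
      by (intro sum.cong) auto
    also have "\<dots> = f m"
      by (subst sum.delta) (auto simp: le_fun_def)
    finally show "(\<Sum>a\<in>{..m}. (if a = (\<lambda>_. 0) then 1 else 0) * f (\<lambda>i. m i - a i)) = f m" .
  qed
  show "f * g * h = f * (g * h)"
  proof (transfer, rule ext)
    fix f g h :: "('b \<Rightarrow> nat) \<Rightarrow> 'a" and m :: "'b \<Rightarrow> nat"
    have "(\<Sum>a\<in>{..m}. (\<Sum>b\<in>{..a}. f b * g (\<lambda>i. a i - b i)) * h (\<lambda>i. m i - a i))
        = (\<Sum>(a,b)\<in>Sigma {..m} (\<lambda>a. {..a}). f b * g (\<lambda>i. a i - b i) * h (\<lambda>i. m i - a i))"
      by (simp add: sum_distrib_right sum.Sigma)
    also have "\<dots> = (\<Sum>(b,c)\<in>Sigma {..m} (\<lambda>b. {..\<lambda>i. m i - b i}).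
                     f b * (g c * h (\<lambda>i. (m i - b i) - c i)))"
    proof (rule sum.reindex_bij_witness
        [where i = "\<lambda>(b, c). (\<lambda>i. b i + c i, b)" and j = "\<lambda>(a, b). (b, \<lambda>i. a i - b i)"],
        goal_cases)
      case (1 x)
      thus ?case by (auto simp: le_fun_def fun_eq_iff)
    next
      case (2 x)
      obtain a b where x: "x = (a, b)" by (cases x)
      have "a i \<le> m i" for i using 2 x by (auto simp: le_fun_def)
      hence "b \<le> m" "(\<lambda>i. a i - b i) \<le> (\<lambda>i. m i - b i)"
        using 2 x by (auto simp: le_fun_def diff_le_mono intro: order_trans)
      thus ?case using x by simp
    next
      case (3 x)
      thus ?case by (auto simp: le_fun_def fun_eq_iff)
    next
      case (4 x)
      obtain b c where x: "x = (b, c)" by (cases x)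
      have "b i \<le> m i \<and> c i \<le> m i - b i" for i
        using 4 x by (auto simp: le_fun_def)
      hence "b i + c i \<le> m i" for i
        by (metis le_diff_conv2 add.commute)
      thus ?case using x by (auto simp: le_fun_def)
    next
      case (5 x)
      obtain a b where x: "x = (a, b)" by (cases x)
      have "a i - b i \<le> m i" "m i - b i - (a i - b i) = m i - a i" for i
      proof -
        have "a i \<le> m i" "b i \<le> a i" using 5 x by (auto simp: le_fun_def)
        thus "a i - b i \<le> m i" "m i - b i - (a i - b i) = m i - a i" by simp_all
      qed
      thus ?case using x by (auto simp: mult.assoc)
    qed
    also have "\<dots> = (\<Sum>b\<in>{..m}. f b * (\<Sum>c\<in>{..\<lambda>i. m i - b i}. g c * h (\<lambda>i. m i - b i - c i)))"
      by (simp add: sum_distrib_left sum.Sigma)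
    finally show "(\<Sum>a\<in>{..m}. (\<Sum>b\<in>{..a}. f b * g (\<lambda>i. a i - b i)) * h (\<lambda>i. m i - a i)) = \<dots>" .
  qed
qed

end

lemma lex_map_add:
  fixes a b c :: "'n \<Rightarrow> nat"
  assumes "(map a xs, map b xs) \<in> lex less_than"
  shows "(map (\<lambda>i. a i + c i) xs, map (\<lambda>i. b i + c i) xs) \<in> lex less_than"
  using assms by (induction xs) auto

lemma lex_map_total:
  fixes a b :: "'n \<Rightarrow> nat"
  assumes "map a xs \<noteq> map b xs"
  shows "(map a xs, map b xs) \<in> lex less_than \<or> (map b xs, map a xs) \<in> lex less_than"
  using assms by (induction xs) auto

instance mps :: (idom, finite) idom
proof
  fix f g :: "('a, 'b) mps"
  assume "f \<noteq> 0" "g \<noteq> 0"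
  obtain xs :: "'b list" where xs: "set xs = UNIV"
    using finite_list[OF finite_class.finite_UNIV] by auto
  define lt where "lt = inv_image (lex less_than) (\<lambda>a :: 'b \<Rightarrow> nat. map a xs)"
  have wf: "wf lt"
    unfolding lt_def by (intro wf_inv_image wf_lex wf_less_than)
  have total: "(a, b) \<in> lt \<or> (b, a) \<in> lt" if "a \<noteq> b" for a b
  proof -
    have "map a xs \<noteq> map b xs" using that xs by (auto simp: fun_eq_iff)
    from lex_map_total[OF this] show ?thesis by (simp add: lt_def in_inv_image)
  qed
  have add_mono: "((\<lambda>i. a i + c i), (\<lambda>i. b i + c i)) \<in> lt" if "(a, b) \<in> lt" for a b c
    using that lex_map_add by (auto simp: lt_def in_inv_image)
  have ex_min: "\<exists>a. mps_coeff h a \<noteq> 0 \<and> (\<forall>b. (b, a) \<in> lt \<longrightarrow> mps_coeff h b = 0)"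
    if h: "h \<noteq> 0" for h :: "('a, 'b) mps"
  proof -
    obtain a where "mps_coeff h a \<noteq> 0"
      using h by (auto simp: mps_eq_iff zero_mps.rep_eq)
    hence "a \<in> {a. mps_coeff h a \<noteq> 0}" by simp
    from wfE_min[OF wf this] obtain c where
      "c \<in> {a. mps_coeff h a \<noteq> 0}" "\<And>b. (b, c) \<in> lt \<Longrightarrow> b \<notin> {a. mps_coeff h a \<noteq> 0}" by blast
    thus ?thesis by (intro exI[of _ c]) simp
  qed
  obtain a where a: "mps_coeff f a \<noteq> 0" "\<And>b. (b, a) \<in> lt \<Longrightarrow> mps_coeff f b = 0"
    using ex_min[OF \<open>f \<noteq> 0\<close>] by blast
  obtain b where b: "mps_coeff g b \<noteq> 0" "\<And>c. (c, b) \<in> lt \<Longrightarrow> mps_coeff g c = 0"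
    using ex_min[OF \<open>g \<noteq> 0\<close>] by blast
  define m where "m = (\<lambda>i. a i + b i)"
  have other: "mps_coeff f c * mps_coeff g (\<lambda>i. m i - c i) = 0"
    if "c \<in> {..m}" "c \<noteq> a" for c
  proof (rule ccontr)
    define d where "d = (\<lambda>i. m i - c i)"
    assume "mps_coeff f c * mps_coeff g (\<lambda>i. m i - c i) \<noteq> 0"
    hence nz: "mps_coeff f c \<noteq> 0" "mps_coeff g d \<noteq> 0" by (auto simp: d_def)
    have cd: "(\<lambda>i. c i + d i) = m" using that by (auto simp: d_def le_fun_def)
    have "(a, c) \<in> lt" using total[of a c] a(2)[of c] nz that by auto
    from add_mono[OF this, of d] have 1: "((\<lambda>i. a i + d i), m) \<in> lt"
      by (simp add: cd)
    have "d = b \<or> (b, d) \<in> lt" using total[of b d] b(2)[of d] nz by auto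
    hence "(m, (\<lambda>i. a i + d i)) \<in> lt \<or> (\<lambda>i. a i + d i) = m"
    proof
      assume "d = b"
      thus ?thesis by (simp add: m_def)
    next
      assume "(b, d) \<in> lt"
      from add_mono[OF this, of a] have "((\<lambda>i. a i + b i), (\<lambda>i. a i + d i)) \<in> lt"
        by (simp only: add.commute)
      thus ?thesis unfolding m_def by (rule disjI1)
    qed
    thus False
    proof
      assume "(m, (\<lambda>i. a i + d i)) \<in> lt"
      from wf_asym[OF wf this] 1 show False by blast
    next
      assume "(\<lambda>i. a i + d i) = m"
      thus False using 1 wf_not_refl[OF wf] by simp
    qed
  qed
  have "mps_coeff (f * g) m = (\<Sum>c\<in>{..m}. mps_coeff f c * mps_coeff g (\<lambda>i. m i - c i))"
    by (simp add: times_mps.rep_eq)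
  also have "\<dots> = (\<Sum>c\<in>{a}. mps_coeff f c * mps_coeff g (\<lambda>i. m i - c i))"
    using other by (intro sum.mono_neutral_right) (auto simp: m_def le_fun_def)
  also have "\<dots> = mps_coeff f a * mps_coeff g b" by (simp add: m_def)
  finally show "f * g \<noteq> 0" using a b by (auto simp: zero_mps.rep_eq)
qed

lift_definition mps_const :: "'a::comm_ring_1 \<Rightarrow> ('a, 'n::finite) mps"
  is "\<lambda>c m. if m = (\<lambda>_. 0) then c else 0" .

lift_definition mps_var :: "'n::finite \<Rightarrow> ('a::comm_ring_1, 'n) mps"
  is "\<lambda>i m. if m = (\<lambda>j. if j = i then 1 else 0) then 1 else 0" .

definition mps_var_ideal :: "('a::comm_ring_1, 'n::finite) mps set" where
  "mps_var_ideal = range (\<lambda>g. \<Sum>i\<in>UNIV. mps_var i * g i)"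


section \<open>Field extensions inside a fixed field\<close>

definition is_subfield :: "'c::field set \<Rightarrow> bool" where
  "is_subfield F \<longleftrightarrow> 0 \<in> F \<and> 1 \<in> F \<and>
     (\<forall>x\<in>F. \<forall>y\<in>F. x + y \<in> F \<and> x * y \<in> F) \<and> (\<forall>x\<in>F. - x \<in> F \<and> inverse x \<in> F)"

definition adjoin :: "'c::field set \<Rightarrow> 'c set \<Rightarrow> 'c set" where
  "adjoin F S = \<Inter>{L. is_subfield L \<and> F \<union> S \<subseteq> L}"

definition algebraic_over :: "'c::field set \<Rightarrow> 'c \<Rightarrow> bool" where
  "algebraic_over F x \<longleftrightarrow> (\<exists>p. p \<noteq> 0 \<and> (\<forall>i. coeff p i \<in> F) \<and> poly p x = 0)"

text \<open>
  A polynomial in variables indexed by \<open>'c\<close> is an element of \<open>('c \<Rightarrow>\<^sub>0 nat) \<Rightarrow>\<^sub>0 'c\<close>; here it is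
  evaluated by sending each variable to the element that indexes it.
\<close>

definition algebraically_independent :: "'c::field set \<Rightarrow> 'c set \<Rightarrow> bool" where
  "algebraically_independent F B \<longleftrightarrow>
     (\<forall>P :: ('c \<Rightarrow>\<^sub>0 nat) \<Rightarrow>\<^sub>0 'c.
        (\<forall>m. Poly_Mapping.lookup P m \<in> F) \<and> (\<forall>m\<in>Poly_Mapping.keys P. Poly_Mapping.keys m \<subseteq> B) \<and>
        (\<Sum>m\<in>Poly_Mapping.keys P. Poly_Mapping.lookup P m *
           (\<Prod>b\<in>Poly_Mapping.keys m. b ^ Poly_Mapping.lookup m b)) = 0
        \<longrightarrow> P = 0)"

definition has_transcendence_degree :: "'c::field set \<Rightarrow> 'c set \<Rightarrow> nat \<Rightarrow> bool" where
  "has_transcendence_degree F L d \<longleftrightarrow>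
     (\<exists>B\<subseteq>L. finite B \<and> card B = d \<and> algebraically_independent F B \<and>
        (\<forall>x\<in>L. algebraic_over (adjoin F B) x))"


section \<open>Discrete valuations and residue fields\<close>

text \<open>
  A valuation is a function to \<open>int\<close>; its value at \<open>0\<close> is meaningless, since
  \<open>v 0 = \<infinity>\<close> mathematically. Every condition below guards against \<open>0\<close> accordingly.
\<close>

definition discrete_valuation :: "('c::field \<Rightarrow> int) \<Rightarrow> bool" where
  "discrete_valuation v \<longleftrightarrow>
     (\<forall>x y. x \<noteq> 0 \<and> y \<noteq> 0 \<longrightarrow> v (x * y) = v x + v y) \<and>
     (\<forall>x y. x \<noteq> 0 \<and> y \<noteq> 0 \<and> x + y \<noteq> 0 \<longrightarrow> min (v x) (v y) \<le> v (x + y)) \<and>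
     v ` (- {0}) = UNIV"

definition valuation_ring :: "('c::field \<Rightarrow> int) \<Rightarrow> 'c set" where
  "valuation_ring v = {x. x = 0 \<or> 0 \<le> v x}"

definition valuation_ideal :: "('c::field \<Rightarrow> int) \<Rightarrow> 'c set" where
  "valuation_ideal v = {x. x = 0 \<or> 0 < v x}"

definition residue :: "('c::field \<Rightarrow> int) \<Rightarrow> 'c \<Rightarrow> 'c set" where
  "residue v x = {y. y - x \<in> valuation_ideal v}"

definition residue_field :: "('c::field \<Rightarrow> int) \<Rightarrow> 'c set set" where
  "residue_field v = residue v ` valuation_ring v"

text \<open>
  Field operations on residue classes are those induced by representatives. The field \<open>F\<close> in
  the next definition lives in a possibly different ambient field.
\<close>

definition residue_field_iso ::
    "('c::field \<Rightarrow> int) \<Rightarrow> ('c set \<Rightarrow> 'd::field) \<Rightarrow> 'd set \<Rightarrow> bool" where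
  "residue_field_iso v \<phi> F \<longleftrightarrow>
     is_subfield F \<and> bij_betw \<phi> (residue_field v) F \<and> \<phi> (residue v 1) = 1 \<and>
     (\<forall>x\<in>valuation_ring v. \<forall>y\<in>valuation_ring v.
        \<phi> (residue v (x + y)) = \<phi> (residue v x) + \<phi> (residue v y) \<and>
        \<phi> (residue v (x * y)) = \<phi> (residue v x) * \<phi> (residue v y))"

definition coefficient_section ::
    "('c::field \<Rightarrow> int) \<Rightarrow> 'c set \<Rightarrow> ('c set \<Rightarrow> 'c) \<Rightarrow> bool" where
  "coefficient_section w K \<sigma> \<longleftrightarrow>
     (\<forall>x\<in>valuation_ring w. \<forall>y\<in>valuation_ring w.
        \<sigma> (residue w (x + y)) = \<sigma> (residue w x) + \<sigma> (residue w y) \<and>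
        \<sigma> (residue w (x * y)) = \<sigma> (residue w x) * \<sigma> (residue w y)) \<and>
     (\<forall>c\<in>K. \<sigma> (residue w c) = c) \<and>
     (\<forall>A\<in>residue_field w. \<sigma> A \<in> valuation_ring w \<and> residue w (\<sigma> A) = A)"

text \<open>
  The completion is taken up to isomorphism: a complete discretely valued field \<open>w\<close>
  together with a value-preserving embedding \<open>\<iota>\<close> with dense image.
\<close>

definition is_completion ::
    "('c::field \<Rightarrow> int) \<Rightarrow> ('c \<Rightarrow> 'd::field) \<Rightarrow> ('d \<Rightarrow> int) \<Rightarrow> bool" where
  "is_completion v \<iota> w \<longleftrightarrow>
     discrete_valuation w \<and>
     \<iota> 1 = 1 \<and> (\<forall>x y. \<iota> (x + y) = \<iota> x + \<iota> y \<and> \<iota> (x * y) = \<iota> x * \<iota> y) \<and>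
     (\<forall>x. x \<noteq> 0 \<longrightarrow> w (\<iota> x) = v x) \<and>
     (\<forall>y N. \<exists>x. y = \<iota> x \<or> N \<le> w (y - \<iota> x)) \<and>
     (\<forall>a :: nat \<Rightarrow> 'd.
        (\<forall>N. \<exists>M. \<forall>p\<ge>M. \<forall>q\<ge>M. a p = a q \<or> N \<le> w (a p - a q)) \<longrightarrow>
        (\<exists>l. \<forall>N. \<exists>M. \<forall>p\<ge>M. a p = l \<or> N \<le> w (a p - l)))"

text \<open>
  The canonical map between residue fields; the sets united here all coincide.
\<close>

definition residue_map :: "('c \<Rightarrow> 'd::field) \<Rightarrow> ('d \<Rightarrow> int) \<Rightarrow> 'c set \<Rightarrow> 'd set" where
  "residue_map \<iota> w A = (\<Union>x\<in>A. residue w (\<iota> x))"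

text \<open>
  \<open>v\<close> is a valuation over the constant field, centered at the maximal ideal of the power series
  ring.
\<close>

definition centered_valuation ::
    "(('k::field, 'n::finite) mps fract \<Rightarrow> int) \<Rightarrow> bool" where
  "centered_valuation v \<longleftrightarrow>
     discrete_valuation v \<and>
     (\<forall>c. c \<noteq> 0 \<longrightarrow> v (to_fract (mps_const c)) = 0) \<and>
     range to_fract \<subseteq> valuation_ring v \<and>
     {f. to_fract f \<in> valuation_ideal v} = mps_var_ideal"


section \<open>The construction\<close>

text \<open>
  Throughout, \<open>K\<close> is the constant field inside the completion, \<open>w\<close> the valuation of the latter, \<open>\<sigma>\<close> is a section of the
  residue map, and the variables are \<open>Y 1, \<dots>, Y n\<close>.
\<close>

definition remainder :: "'c::field \<Rightarrow> 'c \<Rightarrow> (nat \<Rightarrow> 'c) \<Rightarrow> nat \<Rightarrow> 'c" where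
  "remainder y t c s = y - (\<Sum>j=1..s. c j * t ^ j)"

text \<open>
  Coefficients are indexed by every exponent: \<open>c j = 0\<close> when the value of the \<open>j\<close>-th remainder
  exceeds that of \<open>t ^ j\<close>. Membership in the valuation ring says that
  no value lying strictly between consecutive multiples of the value of \<open>t\<close> is met before \<open>s\<close>.
\<close>

definition expands ::
    "('c::field \<Rightarrow> int) \<Rightarrow> ('c set \<Rightarrow> 'c) \<Rightarrow> 'c \<Rightarrow> 'c \<Rightarrow> (nat \<Rightarrow> 'c) \<Rightarrow> nat \<Rightarrow> bool" where
  "expands w \<sigma> y t c s \<longleftrightarrow>
     (\<forall>j\<in>{1..s}. remainder y t c (j - 1) / t ^ j \<in> valuation_ring w \<and>
        c j = \<sigma> (residue w (remainder y t c (j - 1) / t ^ j)))"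

definition situation1 ::
    "('c::field \<Rightarrow> int) \<Rightarrow> ('c set \<Rightarrow> 'c) \<Rightarrow> 'c set \<Rightarrow> 'c \<Rightarrow> 'c \<Rightarrow> (nat \<Rightarrow> 'c) \<Rightarrow> nat \<Rightarrow> bool" where
  "situation1 w \<sigma> \<Delta> t y c s \<longleftrightarrow>
     expands w \<sigma> y t c s \<and> (\<forall>j\<in>{1..s}. algebraic_over \<Delta> (c j)) \<and>
     remainder y t c s \<noteq> 0 \<and> \<not> w t dvd w (remainder y t c s)"

text \<open>
  With \<open>z\<close> the remainder, of value \<open>r\<close> times that of \<open>t\<close>, the residue of \<open>z / t ^ r\<close> is
  transcendental. The section is normalised on it, \<open>u = z / t ^ r\<close>, exactly as it is on the first
  transcendental residue; for other sections the generators found below need not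
  generate the residue field. The new variable \<open>y'\<close> arises from \<open>z\<close> by \<open>r - 1\<close> monoidal
  transformations with respect to \<open>t\<close>.
\<close>

definition situation2 ::
    "('c::field \<Rightarrow> int) \<Rightarrow> ('c set \<Rightarrow> 'c) \<Rightarrow> 'c set \<Rightarrow> 'c \<Rightarrow> 'c \<Rightarrow> (nat \<Rightarrow> 'c) \<Rightarrow> nat \<Rightarrow>
     'c \<Rightarrow> 'c \<Rightarrow> bool" where
  "situation2 w \<sigma> \<Delta> t y c s u y' \<longleftrightarrow>
     expands w \<sigma> y t c s \<and> (\<forall>j\<in>{1..s}. algebraic_over \<Delta> (c j)) \<and>
     (\<exists>z r. z = remainder y t c s \<and> z \<noteq> 0 \<and> w z = int r * w t \<and>
        u = \<sigma> (residue w (z / t ^ r)) \<and> \<not> algebraic_over \<Delta> u \<and>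
        u = z / t ^ r \<and>
        y' = z / t ^ (r - 1))"

definition situation3 ::
    "('c::field \<Rightarrow> int) \<Rightarrow> ('c set \<Rightarrow> 'c) \<Rightarrow> 'c set \<Rightarrow> 'c \<Rightarrow> 'c \<Rightarrow> (nat \<Rightarrow> 'c) \<Rightarrow> bool" where
  "situation3 w \<sigma> \<Delta> t y c \<longleftrightarrow>
     (\<forall>s. expands w \<sigma> y t c s) \<and> (\<forall>j\<ge>1. algebraic_over \<Delta> (c j))"

text \<open>
  One round, carried out for the variables of index \<open>3, \<dots>, p\<close>: \<open>T\<close> is the set of indices in
  situation (2), the others being in situation (3); \<open>U i j\<close> and \<open>u i\<close> are the elements
  $u_{i,j}$ and $u_i$, and \<open>Y'\<close> are the variables afterwards.
\<close>

definition construction_round ::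
    "('c::field \<Rightarrow> int) \<Rightarrow> 'c set \<Rightarrow> nat \<Rightarrow> (nat \<Rightarrow> 'c) \<Rightarrow> ('c set \<Rightarrow> 'c) \<Rightarrow> nat \<Rightarrow> nat set \<Rightarrow>
     (nat \<Rightarrow> nat) \<Rightarrow> (nat \<Rightarrow> nat \<Rightarrow> 'c) \<Rightarrow> (nat \<Rightarrow> 'c) \<Rightarrow> (nat \<Rightarrow> 'c set) \<Rightarrow> (nat \<Rightarrow> 'c) \<Rightarrow> bool" where
  "construction_round w K n Y \<sigma> p T s U u \<Delta> Y' \<longleftrightarrow>
     (\<forall>i\<in>{1..n}. w (Y i) = w (Y 1)) \<and>
     residue w (Y 2 / Y 1) \<notin> residue w ` K \<and>
     coefficient_section w K \<sigma> \<and> \<sigma> (residue w (Y 2 / Y 1)) = Y 2 / Y 1 \<and>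
     u 2 = Y 2 / Y 1 \<and> \<Delta> 2 = adjoin K {u 2} \<and>
     (\<forall>i\<in>{3..p}.
        if i \<in> T
        then situation2 w \<sigma> (\<Delta> (i - 1)) (Y 1) (Y i) (U i) (s i) (u i) (Y' i) \<and>
             \<Delta> i = adjoin (\<Delta> (i - 1)) (U i ` {1..s i} \<union> {u i})
        else situation3 w \<sigma> (\<Delta> (i - 1)) (Y 1) (Y i) (U i) \<and> Y' i = Y i \<and>
             \<Delta> i = adjoin (\<Delta> (i - 1)) (U i ` {1..})) \<and>
     (\<forall>i. i \<notin> {3..p} \<longrightarrow> Y' i = Y i)"

text \<open>
  The sequences of variables reached from \<open>X\<close>. Equalizing is a sequence of the first two kinds of
  step. The third is the search for a first transcendental residue, with coefficients in \<open>K\<close>,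
  and the fourth closes a round that has met situation (1). The second argument
  collects the coefficients $u_{i,j}$ found in the rounds closed so far: the original variables
  are power series in the current ones with coefficients that involve these.
\<close>

inductive construction ::
    "('c::field \<Rightarrow> int) \<Rightarrow> 'c set \<Rightarrow> nat \<Rightarrow> (nat \<Rightarrow> 'c) \<Rightarrow> (nat \<Rightarrow> 'c) \<Rightarrow> 'c set \<Rightarrow> bool"
  for w :: "'c::field \<Rightarrow> int" and K :: "'c set" and n :: nat and X :: "nat \<Rightarrow> 'c" where
  start: "construction w K n X X {}"
| monoidal: "construction w K n X (Y(i := Y i / Y j)) C"
    if "construction w K n X Y C" and "i \<in> {1..n}" and "j \<in> {1..n}" and "w (Y i) > w (Y j)"
| interchange: "construction w K n X (Y(i := Y j, j := Y i)) C"
    if "construction w K n X Y C" and "i \<in> {1..n}" and "j \<in> {1..n}"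
| constant_coefficients: "construction w K n X (Y(i := z)) C"
    if "construction w K n X Y C" and "i \<in> {1..n}" and "j \<in> {1..n}" and "i \<noteq> j"
      and "\<forall>l\<in>{1..n}. w (Y l) = w (Y 1)"
      and "\<forall>l\<in>{1..s}. a l \<in> K \<and>
             residue w (remainder (Y i) (Y j) a (l - 1) / Y j ^ l) = residue w (a l)"
      and "z = remainder (Y i) (Y j) a s" and "z \<noteq> 0"
      and "(\<exists>r. w z = int r * w (Y j) \<and> residue w (z / Y j ^ r) \<notin> residue w ` K) \<or>
           \<not> w (Y j) dvd w z"
| restart: "construction w K n X (Y'(i := remainder (Y i) (Y 1) (U i) (s i)))
      (C \<union> (\<Union>l\<in>{3..<i}. if l \<in> T then U l ` {1..s l} else U l ` {1..}) \<union> U i ` {1..s i})"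
    if "construction w K n X Y C" and "i \<in> {3..n}"
      and "construction_round w K n Y \<sigma> (i - 1) T s U u \<Delta> Y'"
      and "situation1 w \<sigma> (\<Delta> (i - 1)) (Y 1) (Y i) (U i) (s i)"

end

theory Submission
  imports "HOL-Algebra.Algebraic_Closure_Type" Defs
begin

text \<open>
  Fix the final uniformizer \<open>t = Y 1\<close>. For a subfield \<open>D\<close> of the image of \<open>\<sigma>\<close>, the closure
  \<open>E\<close> of \<open>D(t)\<close> in the completion is a closed field whose residues are those of \<open>D\<close>. If \<open>D\<close> contains
  the coefficients of the final round, then \<open>E\<close> contains the final variables. Running the construction
  backwards, a coefficient found in a closed round is algebraic over a trivially valued field
  that already lies in \<open>E\<close>, hence a simple root of a polynomial over \<open>E\<close>; by Newton approximation
  it lies in \<open>E\<close> as soon as its residue is one of \<open>D\<close>. So the original variables, and with them all of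
  \<open>k((X\<^sub>1,\<dots>,X\<^sub>n))\<close>, lie in \<open>E\<close>, and every residue of \<open>v\<close> comes from \<open>D\<close>.

  This is applied twice. When \<open>D\<close> is the relative algebraic closure of \<open>K(u\<^sub>2,\<dots>,u\<^sub>m)\<close>, the residue
  condition is automatic, so the residues of the closed rounds, and therefore \<open>\<Delta>\<^sub>n\<close>, are algebraic
  over \<open>K(u\<^sub>2,\<dots>,u\<^sub>m)\<close>. When \<open>D = \<Delta>\<^sub>n\<close>, the residue condition holds by definition of \<open>\<Delta>\<^sub>n\<close>, and the
  residue field is found to be \<open>\<Delta>\<^sub>n\<close> itself.
\<close>

section \<open>Subfields and algebraic elements\<close>

lemma is_subfieldD:
  assumes "is_subfield F"
  shows "0 \<in> F" "1 \<in> F" "x \<in> F \<Longrightarrow> y \<in> F \<Longrightarrow> x + y \<in> F" "x \<in> F \<Longrightarrow> y \<in> F \<Longrightarrow> x * y \<in> F"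
    "x \<in> F \<Longrightarrow> - x \<in> F" "x \<in> F \<Longrightarrow> inverse x \<in> F"
    "x \<in> F \<Longrightarrow> y \<in> F \<Longrightarrow> x - y \<in> F" "x \<in> F \<Longrightarrow> y \<in> F \<Longrightarrow> x / y \<in> F"
proof -
  show "x \<in> F \<Longrightarrow> y \<in> F \<Longrightarrow> x - y \<in> F"
    using assms unfolding is_subfield_def by (metis diff_conv_add_uminus)
qed (use assms in \<open>auto simp: is_subfield_def divide_inverse\<close>)

lemma subfield_power: "is_subfield F \<Longrightarrow> x \<in> F \<Longrightarrow> x ^ n \<in> F"
  by (induction n) (auto intro: is_subfieldD)

lemma subfield_sum: "is_subfield F \<Longrightarrow> (\<And>i. i \<in> A \<Longrightarrow> f i \<in> F) \<Longrightarrow> sum f A \<in> F"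
  by (induction A rule: infinite_finite_induct) (auto intro: is_subfieldD)

lemma subfield_prod: "is_subfield F \<Longrightarrow> (\<And>i. i \<in> A \<Longrightarrow> f i \<in> F) \<Longrightarrow> prod f A \<in> F"
  by (induction A rule: infinite_finite_induct) (auto intro: is_subfieldD)

lemma subfield_poly: "is_subfield F \<Longrightarrow> (\<And>i. coeff p i \<in> F) \<Longrightarrow> x \<in> F \<Longrightarrow> poly p x \<in> F"
  by (auto simp: poly_altdef intro!: subfield_sum is_subfieldD(4) subfield_power)

lemma subfield_of_nat: "is_subfield F \<Longrightarrow> of_nat n \<in> F"
  by (induction n) (auto intro: is_subfieldD)

lemma subfield_coeff_pderiv:
  "is_subfield F \<Longrightarrow> (\<And>i. coeff p i \<in> F) \<Longrightarrow> coeff (pderiv p) i \<in> F"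
  by (auto simp: coeff_pderiv intro!: is_subfieldD(4) subfield_of_nat simp del: of_nat_Suc)

lemma is_subfield_adjoin [intro, simp]: "is_subfield (adjoin F S)"
  unfolding adjoin_def is_subfield_def by auto

lemma adjoin_base: "x \<in> F \<Longrightarrow> x \<in> adjoin F S"
  and adjoin_gen: "x \<in> S \<Longrightarrow> x \<in> adjoin F S"
  unfolding adjoin_def by auto

lemma adjoin_least: "is_subfield L \<Longrightarrow> F \<subseteq> L \<Longrightarrow> S \<subseteq> L \<Longrightarrow> adjoin F S \<subseteq> L"
  unfolding adjoin_def by auto

lemma algebraic_over_mono: "algebraic_over F x \<Longrightarrow> F \<subseteq> F' \<Longrightarrow> algebraic_over F' x"
  unfolding algebraic_over_def by blast

lemma algebraic_over_self:
  assumes "is_subfield F" "x \<in> F"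
  shows "algebraic_over F x"
  unfolding algebraic_over_def
  using assms by (intro exI[of _ "[:-x, 1:]"]) (auto simp: coeff_pCons is_subfieldD split: nat.splits)

section \<open>Transfer of algebraic elements from HOL-Algebra\<close>

context
begin

interpretation R: Ring.field "ring_of_type_algebra :: 'c::field ring"
  by (rule field_from_type_algebra)

abbreviation (input) "type_ring \<equiv> (ring_of_type_algebra :: 'c::field ring)"

lemma type_ring_simps:
  "carrier (ring_of_type_algebra :: 'c ring) = UNIV"
  "x \<otimes>\<^bsub>ring_of_type_algebra\<^esub> y = (x * y :: 'c)"
  "x \<oplus>\<^bsub>ring_of_type_algebra\<^esub> y = (x + y :: 'c)"
  "\<zero>\<^bsub>ring_of_type_algebra\<^esub> = (0 :: 'c)"
  "\<one>\<^bsub>ring_of_type_algebra\<^esub> = (1 :: 'c::field)"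
  by (simp_all add: ring_of_type_algebra_def)

lemma type_ring_power: "x [^]\<^bsub>ring_of_type_algebra\<^esub> (n::nat) = (x ^ n :: 'c::field)"
  by (induction n) (simp_all add: type_ring_simps)

lemma type_ring_minus: "\<ominus>\<^bsub>ring_of_type_algebra\<^esub> x = (- x :: 'c::field)"
  by (rule R.minus_equality) (simp_all add: type_ring_simps)

lemma type_ring_inverse:
  "x \<noteq> 0 \<Longrightarrow> inv\<^bsub>ring_of_type_algebra\<^esub> x = (inverse x :: 'c::field)"
  by (rule R.comm_inv_char) (simp_all add: type_ring_simps)

lemma subfield_type_ring: "subfield F (ring_of_type_algebra :: 'c::field ring) \<longleftrightarrow> is_subfield F"
proof
  assume F: "subfield F (ring_of_type_algebra :: 'c ring)"
  note S = subringE[OF subfieldE(1)[OF F]]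
  have "inverse x \<in> F" if "x \<in> F" for x
  proof (cases "x = 0")
    case False
    thus ?thesis
      using R.subfield_m_inv(1)[OF F, of x] that by (auto simp: type_ring_inverse type_ring_simps)
  qed (use S(2) in \<open>simp add: type_ring_simps\<close>)
  thus "is_subfield F"
    using S by (auto simp: is_subfield_def type_ring_simps type_ring_minus)
next
  assume F: "is_subfield F"
  show "subfield F (ring_of_type_algebra :: 'c ring)"
    by (rule R.subfieldI'[OF R.subringI])
       (use F in \<open>auto simp: type_ring_simps type_ring_minus type_ring_inverse intro: is_subfieldD\<close>)
qed

text \<open>List polynomials in HOL-Algebra start with the leading coefficient, whereas
  \<open>Poly\<close> expects the constant term first; hence \<open>rev\<close>.\<close>

lemma type_ring_eval: "R.eval p x = poly (Poly (rev p)) (x :: 'c::field)"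
proof (induction p)
  case (Cons a p)
  thus ?case
    by (simp add: type_ring_simps type_ring_power Poly_append poly_monom)
qed (simp add: type_ring_simps)

lemma algebraic_type_ring:
  assumes "is_subfield F"
  shows "(R.algebraic over F) (x :: 'c::field) \<longleftrightarrow> algebraic_over F x"
proof
  assume "(R.algebraic over F) x"
  then obtain p where p: "p \<in> carrier (F[X]\<^bsub>type_ring\<^esub>)" "p \<noteq> []" "R.eval p x = 0"
    using R.algebraicE[of F x] assms by (auto simp: type_ring_simps subfield_type_ring[symmetric] dest: subfieldE(1))
  have "hd p \<noteq> 0" "set p \<subseteq> F"
    using p by (auto simp: univ_poly_carrier[symmetric] polynomial_def type_ring_simps)
  moreover have "Poly (rev p) \<noteq> 0"
  proof -
    \<comment> \<open>A normalised list has a nonzero head, and after reversal the head is the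
      coefficient of index \<open>length p - 1\<close>.\<close>
    have "coeff (Poly (rev p)) (length p - 1) = hd p"
      using p(2) by (simp add: nth_default_def rev_nth hd_conv_nth)
    with \<open>hd p \<noteq> 0\<close> have "coeff (Poly (rev p)) (length p - 1) \<noteq> 0" by simp
    thus ?thesis by (intro notI) (simp only: coeff_0 simp_thms)
  qed
  moreover have "coeff (Poly (rev p)) i \<in> F" for i
    using \<open>set p \<subseteq> F\<close> assms by (auto simp: nth_default_def rev_nth subset_iff is_subfieldD)
  ultimately show "algebraic_over F x"
    using p(3) unfolding algebraic_over_def type_ring_eval by blast
next
  assume "algebraic_over F x"
  then obtain p where p: "p \<noteq> 0" "\<forall>i. coeff p i \<in> F" "poly p x = 0"
    by (auto simp: algebraic_over_def)
  define q where "q = rev (coeffs p)"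
  have "q \<in> carrier (F[X]\<^bsub>type_ring\<^esub>)"
    unfolding univ_poly_carrier[symmetric] polynomial_def q_def
    using p by (auto simp: type_ring_simps coeffs_def hd_rev last_map)
  moreover have "q \<noteq> []" using p by (simp add: q_def)
  moreover have "R.eval q x = \<zero>\<^bsub>type_ring\<^esub>"
    using p by (simp add: type_ring_eval q_def type_ring_simps)
  ultimately show "(R.algebraic over F) x"
    by (rule R.algebraicI)
qed

lemma is_subfield_algebraics:
  fixes F :: "'c::field set"
  assumes "is_subfield F"
  shows "is_subfield {x. algebraic_over F x}"
  using R.subfield_of_algebraics[of F] assms
  by (simp add: subfield_type_ring algebraic_type_ring type_ring_simps)

text \<open>Only the finitely many coefficients of a polynomial for \<open>x\<close> matter. They
  generate a finite extension \<open>A\<close> of \<open>F\<close>, adjoining \<open>x\<close> to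
  \<open>A\<close> is finite again, and by the tower law \<open>x\<close> lies in a finite extension
  of \<open>F\<close>.\<close>

lemma algebraic_over_trans:
  fixes F :: "'c::field set"
  assumes F: "is_subfield F" and x: "algebraic_over {y. algebraic_over F y} x"
  shows "algebraic_over F x"
proof -
  obtain p where p: "p \<noteq> 0" "\<And>i. algebraic_over F (coeff p i)" "poly p x = 0"
    using x by (auto simp: algebraic_over_def[of "Collect _"])
  define A where "A = R.finite_extension F (coeffs p)"
  have F': "subfield F type_ring" using F by (simp add: subfield_type_ring)
  have cs: "(R.algebraic over F) y" if "y \<in> set (coeffs p)" for y
  proof -
    have "y \<in> range (coeff p)" using that by (simp add: range_coeff)
    thus ?thesis using p(2) F by (auto simp: algebraic_type_ring)
  qed
  have A: "subfield A type_ring" "R.finite_dimension F A"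
    unfolding A_def
    using R.finite_extension_is_subfield[OF F' _ cs] R.finite_extension_finite_dimension(1)[OF F' _ cs]
    by (simp_all add: type_ring_simps)
  have "set (coeffs p) \<subseteq> A"
    unfolding A_def using R.finite_extension_mem[OF subfieldE(1)[OF F']] by (simp add: type_ring_simps)
  \<comment> \<open>Beyond the degree the coefficients are 0, a value that \<open>coeffs p\<close>
    need not list.\<close>
  moreover have "0 \<in> A" using A by (simp add: subfield_type_ring is_subfieldD)
  ultimately have "coeff p i \<in> A" for i
    using range_coeff[of p] rangeI[of "coeff p" i] by auto
  hence "algebraic_over A x" using p unfolding algebraic_over_def by blast
  hence alg: "(R.algebraic over A) x" using A by (simp add: algebraic_type_ring subfield_type_ring)
  have "R.finite_dimension A (R.simple_extension A x)"
    using R.finite_dimension_simple_extension[OF A(1), of x] alg by (simp add: type_ring_simps)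
  hence "R.finite_dimension F (R.simple_extension A x)"
    using R.telescopic_base_dim(1)[OF F' A(1) A(2)] by simp
  moreover have "subring (R.simple_extension A x) type_ring" "x \<in> R.simple_extension A x"
    using R.simple_extension_is_subring[OF subfieldE(1)[OF A(1)], of x]
      R.simple_extension_mem[OF subfieldE(1)[OF A(1)], of x]
    by (simp_all add: type_ring_simps)
  ultimately show ?thesis
    using R.finite_dimension_imp_algebraic[OF F'] F by (simp add: algebraic_type_ring)
qed

end


section \<open>Algebraic independence\<close>

lemma algebraically_independent_empty: "algebraically_independent F {}"
  unfolding algebraically_independent_def
proof (intro allI impI, elim conjE)
  fix P :: "('a \<Rightarrow>\<^sub>0 nat) \<Rightarrow>\<^sub>0 'a"
  assume keys: "\<forall>m\<in>Poly_Mapping.keys P. Poly_Mapping.keys m \<subseteq> {}"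
    and sum: "(\<Sum>m\<in>Poly_Mapping.keys P. Poly_Mapping.lookup P m *
           (\<Prod>b\<in>Poly_Mapping.keys m. b ^ Poly_Mapping.lookup m b)) = 0"
  have sub: "Poly_Mapping.keys P \<subseteq> {0}" using keys by auto
  show "P = 0"
  proof (cases "Poly_Mapping.keys P = {}")
    case False
    hence "Poly_Mapping.keys P = {0}" using subset_singletonD[OF sub] by blast
    thus ?thesis using sum by auto
  qed auto
qed

text \<open>A relation is sorted by powers of \<open>x\<close>. This gives a polynomial
  \<open>Q\<close> in one variable over \<open>F(B)\<close> that vanishes at \<open>x\<close>, so
  \<open>Q = 0\<close>; each of its coefficients is then a relation among elements of
  \<open>B\<close> alone, and the independence of \<open>B\<close> kills it.\<close>

lemma algebraically_independent_insert:
  fixes F B :: "'c::field set"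
  assumes F: "is_subfield F" and ind: "algebraically_independent F B"
    and x: "\<not> algebraic_over (adjoin F B) x"
  shows "algebraically_independent F (insert x B)"
  unfolding algebraically_independent_def
proof (intro allI impI, elim conjE)
  fix P :: "('c \<Rightarrow>\<^sub>0 nat) \<Rightarrow>\<^sub>0 'c"
  define monom_eval where
    "monom_eval m = (\<Prod>b\<in>Poly_Mapping.keys m. b ^ Poly_Mapping.lookup m b)" for m :: "'c \<Rightarrow>\<^sub>0 nat"
  assume coeffs: "\<forall>m. Poly_Mapping.lookup P m \<in> F"
    and keys: "\<forall>m\<in>Poly_Mapping.keys P. Poly_Mapping.keys m \<subseteq> insert x B"
    and "(\<Sum>m\<in>Poly_Mapping.keys P. Poly_Mapping.lookup P m *
           (\<Prod>b\<in>Poly_Mapping.keys m. b ^ Poly_Mapping.lookup m b)) = 0"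
  hence sum: "(\<Sum>m\<in>Poly_Mapping.keys P. Poly_Mapping.lookup P m * monom_eval m) = 0"
    by (simp add: monom_eval_def)
  have xB: "x \<notin> B"
    using x algebraic_over_self[OF is_subfield_adjoin adjoin_gen] by blast
  define e where "e m = Poly_Mapping.lookup m x" for m :: "'c \<Rightarrow>\<^sub>0 nat"
  \<comment> \<open>The exponent of \<open>x\<close> is split off: \<open>e m\<close> records it and
    \<open>rest m\<close> is the monomial with that exponent set to 0.\<close>
  define rest where "rest m = Poly_Mapping.update x 0 m" for m :: "'c \<Rightarrow>\<^sub>0 nat"
  have keys_rest: "Poly_Mapping.keys (rest m) = Poly_Mapping.keys m - {x}" for m
    by (auto simp: rest_def keys_update)
  have eval_rest: "monom_eval m = monom_eval (rest m) * x ^ e m" for m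
  proof (cases "x \<in> Poly_Mapping.keys m")
    case True
    have "monom_eval m = x ^ e m * (\<Prod>b\<in>Poly_Mapping.keys m - {x}. b ^ Poly_Mapping.lookup m b)"
      unfolding monom_eval_def e_def by (rule prod.remove) (use True in auto)
    also have "(\<Prod>b\<in>Poly_Mapping.keys m - {x}. b ^ Poly_Mapping.lookup m b) = monom_eval (rest m)"
      unfolding monom_eval_def keys_rest by (intro prod.cong) (auto simp: rest_def lookup_update)
    finally show ?thesis by (simp add: mult.commute)
  next
    case False
    hence "e m = 0" by (simp add: e_def in_keys_iff)
    moreover from this have "rest m = m"
      by (intro poly_mapping_eqI) (auto simp: rest_def e_def lookup_update)
    ultimately show ?thesis by simp
  qed
  define c where
    "c d = (\<Sum>m\<in>{m\<in>Poly_Mapping.keys P. e m = d}. Poly_Mapping.lookup P m * monom_eval (rest m))" for d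
  define D where "D = e ` Poly_Mapping.keys P"
  define Q where "Q = (\<Sum>d\<in>D. monom (c d) d)"
  have "finite D" by (simp add: D_def)
  have coeff_Q: "coeff Q d = (if d \<in> D then c d else 0)" for d
    using \<open>finite D\<close> by (simp add: Q_def coeff_sum)
  have c_mem: "c d \<in> adjoin F B" for d
  proof -
    have "Poly_Mapping.lookup P m * monom_eval (rest m) \<in> adjoin F B"
      if m: "m \<in> Poly_Mapping.keys P" for m
    proof (rule is_subfieldD(4)[OF is_subfield_adjoin])
      show "Poly_Mapping.lookup P m \<in> adjoin F B"
        using coeffs by (simp add: adjoin_base)
      have "Poly_Mapping.keys m - {x} \<subseteq> adjoin F B"
        using keys m adjoin_gen[of _ B F] by blast
      thus "monom_eval (rest m) \<in> adjoin F B"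
        unfolding monom_eval_def keys_rest
        by (intro subfield_prod[OF is_subfield_adjoin] subfield_power[OF is_subfield_adjoin]) blast
    qed
    thus ?thesis unfolding c_def by (intro subfield_sum[OF is_subfield_adjoin]) simp
  qed
  have "poly Q x = (\<Sum>d\<in>D. c d * x ^ d)"
    by (simp add: Q_def poly_sum poly_monom)
  also have "\<dots> = (\<Sum>d\<in>D. \<Sum>m\<in>{m\<in>Poly_Mapping.keys P. e m = d}. Poly_Mapping.lookup P m * monom_eval m)"
  proof (rule sum.cong[OF refl])
    fix d
    have eq: "Poly_Mapping.lookup P m * monom_eval m = Poly_Mapping.lookup P m * monom_eval (rest m) * x ^ d"
      if "e m = d" for m
      using eval_rest[of m] that by (simp only: mult.assoc)
    thus "c d * x ^ d =
        (\<Sum>m\<in>{m\<in>Poly_Mapping.keys P. e m = d}. Poly_Mapping.lookup P m * monom_eval m)"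
      unfolding c_def sum_distrib_right by (intro sum.cong refl eq[symmetric]) simp
  qed
  also have "\<dots> = (\<Sum>m\<in>Poly_Mapping.keys P. Poly_Mapping.lookup P m * monom_eval m)"
    unfolding D_def by (rule sum.image_gen[symmetric]) simp
  finally have "poly Q x = 0" using sum by simp
  moreover have "\<forall>d. coeff Q d \<in> adjoin F B"
    using c_mem by (simp add: coeff_Q is_subfieldD)
  ultimately have "Q = 0"
    using x unfolding algebraic_over_def by blast
  hence c0: "c d = 0" if "d \<in> D" for d
    using coeff_Q[of d] that by simp
  show "P = 0"
  proof (rule ccontr)
    assume "P \<noteq> 0"
    then obtain m where m: "m \<in> Poly_Mapping.keys P"
      using keys_eq_empty[of P] by blast
    define d where "d = e m"
    define M where "M = {m\<in>Poly_Mapping.keys P. e m = d}"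
    have finM: "finite M" by (simp add: M_def)
    \<comment> \<open>All monomials in \<open>M\<close> have the same exponent \<open>d\<close> at
      \<open>x\<close>, so deleting it merges no two of them. The coefficients of \<open>P\<close>
      on \<open>M\<close> can therefore be moved to a polynomial \<open>P'\<close> in
      \<open>B\<close> whose value is \<open>c d\<close>.\<close>
    have inj: "inj_on rest M"
    proof
      fix m m' assume "m \<in> M" "m' \<in> M" "rest m = rest m'"
      have "Poly_Mapping.lookup m y = Poly_Mapping.lookup m' y" for y
      proof (cases "y = x")
        case True
        thus ?thesis using \<open>m \<in> M\<close> \<open>m' \<in> M\<close> by (simp add: M_def e_def)
      next
        case False
        have "Poly_Mapping.lookup (rest m) y = Poly_Mapping.lookup (rest m') y"
          using \<open>rest m = rest m'\<close> by simp
        thus ?thesis using False by (simp add: rest_def lookup_update)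
      qed
      thus "m = m'" by (rule poly_mapping_eqI)
    qed
    define P' where "P' = Abs_poly_mapping (\<lambda>m. if m \<in> rest ` M then
       Poly_Mapping.lookup P (the_inv_into M rest m) else 0)"
    have lookup_P': "Poly_Mapping.lookup P' = (\<lambda>m. if m \<in> rest ` M then
       Poly_Mapping.lookup P (the_inv_into M rest m) else 0)"
      unfolding P'_def
      by (rule lookup_Abs_poly_mapping, rule finite_subset[of _ "rest ` M"]) (use finM in auto)
    have P'_rest: "Poly_Mapping.lookup P' (rest m) = Poly_Mapping.lookup P m" if "m \<in> M" for m
      using that by (simp add: lookup_P' the_inv_into_f_f[OF inj])
    have keys_P': "Poly_Mapping.keys P' = rest ` M"
    proof
      show "Poly_Mapping.keys P' \<subseteq> rest ` M"
        by (auto simp: in_keys_iff lookup_P' split: if_splits)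
      show "rest ` M \<subseteq> Poly_Mapping.keys P'"
        by (auto simp: in_keys_iff P'_rest M_def)
    qed
    have "(\<Sum>m\<in>Poly_Mapping.keys P'. Poly_Mapping.lookup P' m * monom_eval m) = c d"
      unfolding keys_P' c_def M_def[symmetric]
      by (subst sum.reindex[OF inj]) (auto simp: P'_rest intro!: sum.cong)
    also have "\<dots> = 0" using c0 m by (auto simp: d_def D_def)
    finally have "(\<Sum>m\<in>Poly_Mapping.keys P'. Poly_Mapping.lookup P' m *
           (\<Prod>b\<in>Poly_Mapping.keys m. b ^ Poly_Mapping.lookup m b)) = 0"
      by (simp add: monom_eval_def)
    moreover have "\<forall>m. Poly_Mapping.lookup P' m \<in> F"
      using coeffs is_subfieldD(1)[OF F] by (simp add: lookup_P')
    moreover have "\<forall>m\<in>Poly_Mapping.keys P'. Poly_Mapping.keys m \<subseteq> B"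
      using keys by (auto simp: keys_P' keys_rest M_def)
    ultimately have "P' = 0"
      using ind unfolding algebraically_independent_def by blast
    moreover have "m \<in> M" using m by (simp add: M_def d_def)
    ultimately show False using keys_P' by auto
  qed
qed


section \<open>Discretely valued fields\<close>

locale valued_field =
  fixes w :: "'c::field \<Rightarrow> int"
  assumes valuation: "discrete_valuation w"
begin

lemma w_mult: "x \<noteq> 0 \<Longrightarrow> y \<noteq> 0 \<Longrightarrow> w (x * y) = w x + w y"
  using valuation by (simp add: discrete_valuation_def)

lemma w_add: "x \<noteq> 0 \<Longrightarrow> y \<noteq> 0 \<Longrightarrow> x + y \<noteq> 0 \<Longrightarrow> min (w x) (w y) \<le> w (x + y)"
  using valuation by (simp add: discrete_valuation_def)

lemma w_one [simp]: "w 1 = 0"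
  using w_mult[of 1 1] by simp

lemma w_uminus [simp]: "w (- x) = w x"
proof (cases "x = 0")
  case False
  have "w (- 1) = 0" using w_mult[of "- 1" "- 1"] by simp
  thus ?thesis using w_mult[of "- 1" x] False by simp
qed simp

lemma w_inverse: "x \<noteq> 0 \<Longrightarrow> w (inverse x) = - w x"
  using w_mult[of x "inverse x"] by simp

lemma w_divide: "x \<noteq> 0 \<Longrightarrow> y \<noteq> 0 \<Longrightarrow> w (x / y) = w x - w y"
  by (simp add: divide_inverse w_mult w_inverse)

lemma w_power: "x \<noteq> 0 \<Longrightarrow> w (x ^ n) = int n * w x"
  by (induction n) (simp_all add: w_mult algebra_simps)

text \<open>The valuation has no meaningful value at 0; this predicate treats it as infinite, which
  makes the ultrametric estimates free of case distinctions.\<close>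

definition value_ge :: "int \<Rightarrow> 'c \<Rightarrow> bool" where
  "value_ge N x \<longleftrightarrow> x = 0 \<or> N \<le> w x"

lemma value_ge_0 [simp]: "value_ge N 0"
  by (simp add: value_ge_def)

lemma value_ge_one [simp]: "value_ge 0 1"
  by (simp add: value_ge_def)

lemma value_ge_mono: "value_ge N x \<Longrightarrow> M \<le> N \<Longrightarrow> value_ge M x"
  by (auto simp: value_ge_def)

lemma value_ge_add: "value_ge N x \<Longrightarrow> value_ge N y \<Longrightarrow> value_ge N (x + y)"
  using w_add[of x y] by (cases "x = 0 \<or> y = 0 \<or> x + y = 0") (auto simp: value_ge_def)

lemma value_ge_uminus [simp]: "value_ge N (- x) \<longleftrightarrow> value_ge N x"
  by (simp add: value_ge_def)

lemma value_ge_diff: "value_ge N x \<Longrightarrow> value_ge N y \<Longrightarrow> value_ge N (x - y)"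
  using value_ge_add[of N x "- y"] by simp

lemma value_ge_commute: "value_ge N (x - y) \<longleftrightarrow> value_ge N (y - x)"
  using value_ge_uminus[of N "x - y"] by simp

lemma value_ge_trans: "value_ge N (x - y) \<Longrightarrow> value_ge N (y - z) \<Longrightarrow> value_ge N (x - z)"
  using value_ge_add[of N "x - y" "y - z"] by simp

lemma value_ge_mult: "value_ge M x \<Longrightarrow> value_ge N y \<Longrightarrow> value_ge (M + N) (x * y)"
  by (cases "x = 0 \<or> y = 0") (auto simp: value_ge_def w_mult)

lemma value_ge_mult_left: "value_ge 0 x \<Longrightarrow> value_ge N y \<Longrightarrow> value_ge N (x * y)"
  using value_ge_mult[of 0 x N y] by simp

lemma value_ge_mult_right: "value_ge N x \<Longrightarrow> value_ge 0 y \<Longrightarrow> value_ge N (x * y)"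
  using value_ge_mult[of N x 0 y] by simp

lemma value_ge_sum: "(\<And>i. i \<in> A \<Longrightarrow> value_ge N (f i)) \<Longrightarrow> value_ge N (sum f A)"
  by (induction A rule: infinite_finite_induct) (auto intro: value_ge_add)

lemma value_ge_of_nat: "value_ge 0 (of_nat n)"
  by (induction n) (auto intro: value_ge_add)

lemma value_ge_exists: "\<exists>M\<le>0. value_ge M x"
  by (intro exI[of _ "min 0 (w x)"]) (auto simp: value_ge_def)

text \<open>The ultrametric inequality in both directions: a perturbation of value greater than
  \<open>w x\<close> can neither raise nor lower the value of \<open>x\<close>.\<close>

lemma w_eq_of_close:
  assumes "x \<noteq> 0" "value_ge (w x + 1) (x - y)"
  shows "y \<noteq> 0 \<and> w y = w x"
proof -
  have "y \<noteq> 0" using assms by (auto simp: value_ge_def)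
  moreover have "w y = w x"
  proof (cases "x = y")
    case False
    hence "w x < w (x - y)" using assms by (auto simp: value_ge_def)
    moreover have "min (w y) (w (x - y)) \<le> w x"
      using w_add[of y "x - y"] \<open>y \<noteq> 0\<close> False assms by simp
    moreover have "min (w x) (w (x - y)) \<le> w y"
      using w_add[of x "y - x"] w_uminus[of "x - y"] \<open>y \<noteq> 0\<close> False assms by simp
    ultimately show ?thesis by linarith
  qed simp
  ultimately show ?thesis ..
qed

lemma valuation_ring_iff: "x \<in> valuation_ring w \<longleftrightarrow> value_ge 0 x"
  by (auto simp: valuation_ring_def value_ge_def)

lemma valuation_ideal_iff: "x \<in> valuation_ideal w \<longleftrightarrow> value_ge 1 x"
  by (auto simp: valuation_ideal_def value_ge_def)

lemma residue_eq_iff: "residue w x = residue w y \<longleftrightarrow> value_ge 1 (x - y)"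
proof
  assume "residue w x = residue w y"
  moreover have "x \<in> residue w x" by (simp add: residue_def valuation_ideal_iff)
  ultimately show "value_ge 1 (x - y)" by (simp add: residue_def valuation_ideal_iff)
next
  assume "value_ge 1 (x - y)"
  thus "residue w x = residue w y"
    unfolding residue_def valuation_ideal_iff
    by (auto intro: value_ge_trans simp: value_ge_commute[of _ y x])
qed


subsection \<open>Closed subfields\<close>

text \<open>The topological closure for the topology of the valuation.\<close>

definition val_closure :: "'c set \<Rightarrow> 'c set" where
  "val_closure E = {x. \<forall>N. \<exists>y\<in>E. value_ge N (x - y)}"

definition val_closed :: "'c set \<Rightarrow> bool" where
  "val_closed E \<longleftrightarrow> val_closure E \<subseteq> E"

lemma subset_val_closure: "E \<subseteq> val_closure E"
  by (auto simp: val_closure_def intro!: bexI)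

lemma val_closed_val_closure: "val_closed (val_closure E)"
  unfolding val_closed_def
proof
  fix x assume x: "x \<in> val_closure (val_closure E)"
  show "x \<in> val_closure E"
    unfolding val_closure_def
  proof (rule CollectI, rule allI)
    fix N
    obtain y where y: "y \<in> val_closure E" "value_ge N (x - y)"
      using x by (auto simp: val_closure_def[of "val_closure E"])
    then obtain z where "z \<in> E" "value_ge N (y - z)"
      by (auto simp: val_closure_def)
    thus "\<exists>z\<in>E. value_ge N (x - z)" using y value_ge_trans by blast
  qed
qed

lemma val_closedD: "val_closed E \<Longrightarrow> (\<And>N. \<exists>y\<in>E. value_ge N (x - y)) \<Longrightarrow> x \<in> E"
  by (auto simp: val_closed_def val_closure_def)

lemma is_subfield_val_closure:
  assumes F: "is_subfield F"
  shows "is_subfield (val_closure F)"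
  unfolding is_subfield_def
proof (intro conjI ballI)
  show "0 \<in> val_closure F" "1 \<in> val_closure F"
    using subset_val_closure is_subfieldD[OF F] by auto
next
  fix x y assume x: "x \<in> val_closure F" and y: "y \<in> val_closure F"
  show "x + y \<in> val_closure F"
    unfolding val_closure_def
  proof (rule CollectI, rule allI)
    fix N
    obtain x' y' where "x' \<in> F" "value_ge N (x - x')" "y' \<in> F" "value_ge N (y - y')"
      using x y by (force simp: val_closure_def)
    thus "\<exists>z\<in>F. value_ge N (x + y - z)"
      using value_ge_add[of N "x - x'" "y - y'"]
      by (intro bexI[of _ "x' + y'"]) (auto simp: algebra_simps is_subfieldD[OF F])
  qed
  show "x * y \<in> val_closure F"
    unfolding val_closure_def
  proof (rule CollectI, rule allI)
    fix N
    obtain L M where LM: "value_ge L x" "value_ge M y" using value_ge_exists by metis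
    \<comment> \<open>The precision \<open>N - L\<close> makes \<open>x * (y - y')\<close> small;
      the precision \<open>M\<close> lets \<open>y'\<close> inherit the lower bound of
      \<open>y\<close>, which controls \<open>(x - x') * y'\<close>.\<close>
    obtain y' where y': "y' \<in> F" "value_ge (max (N - L) M) (y - y')"
      using y by (force simp: val_closure_def)
    obtain x' where x': "x' \<in> F" "value_ge (N - M) (x - x')"
      using x by (force simp: val_closure_def)
    have "value_ge M y'"
      using value_ge_diff[of M y "y - y'"] LM value_ge_mono[OF y'(2), of M] by simp
    hence "value_ge N ((x - x') * y')" using value_ge_mult[OF x'(2), of M y'] by simp
    moreover have "value_ge N (x * (y - y'))"
      using value_ge_mult[OF LM(1) value_ge_mono[OF y'(2), of "N - L"]] by simp
    moreover have "x * y - x' * y' = x * (y - y') + (x - x') * y'" by (simp add: algebra_simps)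
    ultimately show "\<exists>z\<in>F. value_ge N (x * y - z)"
      using x' y' value_ge_add by (intro bexI[of _ "x' * y'"]) (auto simp: is_subfieldD[OF F])
  qed
next
  fix x assume x: "x \<in> val_closure F"
  show "- x \<in> val_closure F"
    unfolding val_closure_def
  proof (rule CollectI, rule allI)
    fix N
    obtain x' where "x' \<in> F" "value_ge N (x - x')"
      using x by (force simp: val_closure_def)
    thus "\<exists>z\<in>F. value_ge N (- x - z)"
      using value_ge_commute[of N x x']
      by (intro bexI[of _ "- x'"]) (auto simp: is_subfieldD[OF F])
  qed
  show "inverse x \<in> val_closure F"
  proof (cases "x = 0")
    case False
    show ?thesis
      unfolding val_closure_def
    proof (rule CollectI, rule allI)
      fix N
      \<comment> \<open>The summand \<open>2 * w x\<close> pays for the denominator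
        \<open>x * y\<close> in the difference of the inverses; the bound \<open>w x + 1\<close>
        forces \<open>y\<close> to be nonzero and of the same value as \<open>x\<close>.\<close>
      obtain y where y: "y \<in> F" "value_ge (max (N + 2 * w x) (w x + 1)) (x - y)"
        using x by (force simp: val_closure_def)
      have y': "y \<noteq> 0" "w y = w x"
        using w_eq_of_close[OF False value_ge_mono[OF y(2)]] by auto
      have "value_ge (- 2 * w x) (inverse (x * y))"
        using y' False by (auto simp: value_ge_def w_inverse w_mult)
      moreover have "value_ge (N + 2 * w x) (y - x)"
        using value_ge_mono[OF y(2), of "N + 2 * w x"] by (simp add: value_ge_commute)
      ultimately have "value_ge N ((y - x) * inverse (x * y))"
        using value_ge_mult[of "N + 2 * w x" "y - x" "- 2 * w x"] by simp
      also have "(y - x) * inverse (x * y) = inverse x - inverse y"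
        using y' False by (simp add: field_simps)
      finally show "\<exists>z\<in>F. value_ge N (inverse x - z)"
        using y(1) is_subfieldD(6)[OF F] by blast
    qed
  qed (use x in simp)
qed


subsection \<open>Newton approximation\<close>

lemma value_ge_poly:
  "(\<And>i. value_ge 0 (coeff p i)) \<Longrightarrow> value_ge 0 x \<Longrightarrow> value_ge 0 (poly p x)"
proof (induction p)
  case (pCons a p)
  have "value_ge 0 (coeff p i)" for i using pCons.prems(1)[of "Suc i"] by simp
  moreover have "value_ge 0 a" using pCons.prems(1)[of 0] by simp
  ultimately show ?case
    using pCons by (auto intro!: value_ge_add value_ge_mult_left)
qed simp

lemma value_ge_coeff_pderiv: "(\<And>i. value_ge 0 (coeff p i)) \<Longrightarrow> value_ge 0 (coeff (pderiv p) i)"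
  by (auto simp: coeff_pderiv intro!: value_ge_mult_left value_ge_of_nat simp del: of_nat_Suc)

lemma poly_first_order:
  assumes "\<And>i. value_ge 0 (coeff p i)" "value_ge 0 x" "value_ge 0 h"
  shows "\<exists>g. value_ge 0 g \<and> poly p (x + h) = poly p x + h * g"
  using assms(1)
proof (induction p)
  case (pCons a p)
  have c: "value_ge 0 (coeff p i)" for i using pCons.prems[of "Suc i"] by simp
  then obtain g where g: "value_ge 0 g" "poly p (x + h) = poly p x + h * g"
    using pCons.IH by blast
  show ?case
  proof (intro exI conjI)
    show "value_ge 0 (poly p x + (x + h) * g)"
      using assms c g by (intro value_ge_add value_ge_mult_left value_ge_poly)
    show "poly (pCons a p) (x + h) = poly (pCons a p) x + h * (poly p x + (x + h) * g)"
      using g(2) by (simp add: algebra_simps)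
  qed
qed (auto intro!: exI[of _ 0])

text \<open>Taylor expansion with an integral cofactor of the quadratic term. The cofactor is built
  along the Horner scheme, so no factorial is divided by.\<close>

lemma poly_second_order:
  assumes "\<And>i. value_ge 0 (coeff p i)" "value_ge 0 x" "value_ge 0 h"
  shows "\<exists>g. value_ge 0 g \<and> poly p (x + h) = poly p x + h * poly (pderiv p) x + h\<^sup>2 * g"
  using assms(1)
proof (induction p)
  case (pCons a p)
  have c: "value_ge 0 (coeff p i)" for i using pCons.prems[of "Suc i"] by simp
  then obtain g where g: "value_ge 0 g"
      "poly p (x + h) = poly p x + h * poly (pderiv p) x + h\<^sup>2 * g"
    using pCons.IH by blast
  show ?case
  proof (intro exI conjI)
    show "value_ge 0 (poly (pderiv p) x + (x + h) * g)"
      using assms c g by (intro value_ge_add value_ge_mult_left value_ge_poly value_ge_coeff_pderiv)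
    show "poly (pCons a p) (x + h) = poly (pCons a p) x + h * poly (pderiv (pCons a p)) x
        + h\<^sup>2 * (poly (pderiv p) x + (x + h) * g)"
      using g(2) by (simp add: pderiv_pCons algebra_simps power2_eq_square)
  qed
qed (auto intro!: exI[of _ 0])

lemma value_ge_power: "value_ge 0 x \<Longrightarrow> value_ge 0 (x ^ n)"
  by (induction n) (auto intro: value_ge_mult_left)

text \<open>The derivative being a unit at \<open>c\<close> says that the residue of
  \<open>c\<close> is a simple root of the reduced polynomial. The element \<open>c\<close> itself
  is not assumed to lie in \<open>E\<close>.\<close>

definition simple_root_over :: "'c set \<Rightarrow> 'c \<Rightarrow> bool" where
  "simple_root_over E c \<longleftrightarrow> value_ge 0 c \<and>
     (\<exists>p. (\<forall>i. coeff p i \<in> E \<and> value_ge 0 (coeff p i)) \<and> poly p c = 0 \<and>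
          poly (pderiv p) c \<noteq> 0 \<and> w (poly (pderiv p) c) = 0)"

text \<open>
  The root is known to exist in the ambient field, so the Newton iteration needs neither
  completeness of \<open>E\<close> nor a separate convergence argument.
\<close>

lemma newton_simple_root:
  assumes E: "is_subfield E" "val_closed E" and c: "simple_root_over E c"
    and c0: "c0 \<in> E" "value_ge 1 (c - c0)"
  shows "c \<in> E"
proof -
  obtain p where cE: "\<And>i. coeff p i \<in> E" and cR: "\<And>i. value_ge 0 (coeff p i)"
    and p: "poly p c = 0" "poly (pderiv p) c \<noteq> 0" "w (poly (pderiv p) c) = 0" and c: "value_ge 0 c"
    using c unfolding simple_root_over_def by blast
  have approx: "\<exists>y\<in>E. value_ge (1 + int k) (c - y)" for k
  proof (induction k)
    case 0
    show ?case using c0 by auto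
  next
    case (Suc k)
    then obtain y where y: "y \<in> E" "value_ge (1 + int k) (c - y)" by blast
    define h where "h = y - c"
    have h: "value_ge (1 + int k) h" using y by (simp add: h_def value_ge_commute)
    hence h0: "value_ge 0 h" by (rule value_ge_mono) simp
    obtain g where g: "value_ge 0 g" "poly p y = h * poly (pderiv p) c + h\<^sup>2 * g"
      using poly_second_order[OF cR c h0] p by (auto simp: h_def)
    obtain g' where g': "value_ge 0 g'" "poly (pderiv p) y = poly (pderiv p) c + h * g'"
      using poly_first_order[OF value_ge_coeff_pderiv[OF cR] c h0] by (auto simp: h_def)
    have "value_ge 1 (h * g')"
      using value_ge_mult_right[OF value_ge_mono[OF h] g'(1), of 1] by simp
    \<comment> \<open>Since \<open>h\<close> has positive value, the derivative at \<open>y\<close>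
      has the same residue as the one at \<open>c\<close> and stays a unit.\<close>
    hence d: "poly (pderiv p) y \<noteq> 0" "w (poly (pderiv p) y) = 0"
      using w_eq_of_close[OF p(2), of "poly (pderiv p) y"] p(3) g'(2) by auto
    define z where "z = y - poly p y / poly (pderiv p) y"
    have "z \<in> E"
      unfolding z_def using cE y(1) subfield_coeff_pderiv[OF E(1)]
      by (intro is_subfieldD(7,8)[OF E(1)] subfield_poly[OF E(1)]) auto
    \<comment> \<open>The terms linear in \<open>h\<close> cancel in a Newton step. The new error is
      the square of \<open>h\<close> times an integral factor, so its value at least doubles, which
      is more than the gain of 1 needed here.\<close>
    have "z - c = h - (h * poly (pderiv p) c + h\<^sup>2 * g) / poly (pderiv p) y"
      using g(2) by (simp add: z_def h_def)
    also have "\<dots> = (h * (poly (pderiv p) c + h * g') - (h * poly (pderiv p) c + h\<^sup>2 * g)) / poly (pderiv p) y"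
      using d(1) unfolding g'(2)[symmetric] by (simp add: field_simps)
    also have "\<dots> = h * (h * ((g' - g) * inverse (poly (pderiv p) y)))"
      by (simp add: divide_inverse power2_eq_square algebra_simps)
    finally have eq: "z - c = h * (h * ((g' - g) * inverse (poly (pderiv p) y)))" .
    have "value_ge 0 (inverse (poly (pderiv p) y))" using d by (simp add: value_ge_def w_inverse)
    hence "value_ge 0 ((g' - g) * inverse (poly (pderiv p) y))"
      using g(1) g'(1) by (intro value_ge_mult_left value_ge_diff)
    hence "value_ge (1 + int k + (1 + int k)) (z - c)"
      unfolding eq by (intro value_ge_mult[OF h] value_ge_mult_right[OF h])
    hence "value_ge (1 + int (Suc k)) (c - z)"
      using value_ge_mono[of _ "z - c" "1 + int (Suc k)"] by (simp add: value_ge_commute)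
    thus ?case using \<open>z \<in> E\<close> by blast
  qed
  show ?thesis
  proof (rule val_closedD[OF E(2)])
    fix N
    obtain y where "y \<in> E" "value_ge (1 + int (nat N)) (c - y)" using approx by blast
    moreover from this(2) have "value_ge N (c - y)" by (rule value_ge_mono) simp
    ultimately show "\<exists>y\<in>E. value_ge N (c - y)" by blast
  qed
qed

end

context valued_field
begin

subsection \<open>Laurent series over a trivially valued subfield\<close>

definition trivially_valued :: "'c set \<Rightarrow> bool" where
  "trivially_valued D \<longleftrightarrow> (\<forall>x\<in>D. x \<noteq> 0 \<longrightarrow> w x = 0)"

lemma trivially_valued_value_ge: "trivially_valued D \<Longrightarrow> x \<in> D \<Longrightarrow> value_ge 0 x"
  by (auto simp: trivially_valued_def value_ge_def)

lemma trivially_valued_eq_0: "trivially_valued D \<Longrightarrow> x \<in> D \<Longrightarrow> value_ge 1 x \<Longrightarrow> x = 0"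
  by (auto simp: trivially_valued_def value_ge_def)

lemma trivially_valued_mono: "trivially_valued D \<Longrightarrow> D' \<subseteq> D \<Longrightarrow> trivially_valued D'"
  by (auto simp: trivially_valued_def)

text \<open>The field \<open>D(t)\<close>, kept as explicit quotients instead of an
  \<open>adjoin\<close>, so that residues can be read off from numerator and denominator.\<close>

definition rational_expressions :: "'c set \<Rightarrow> 'c \<Rightarrow> 'c set" where
  "rational_expressions D t =
     {poly p t / poly q t | p q. (\<forall>i. coeff p i \<in> D) \<and> (\<forall>i. coeff q i \<in> D) \<and> q \<noteq> 0}"

text \<open>For trivially valued \<open>D\<close>, a uniformizer \<open>t\<close> and a complete
  ambient field, this is the field of Laurent series in \<open>t\<close> over
  \<open>D\<close>.\<close>

definition laurent_field :: "'c set \<Rightarrow> 'c \<Rightarrow> 'c set" where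
  "laurent_field D t = val_closure (rational_expressions D t)"

context
  fixes D :: "'c set" and t :: 'c
  assumes D: "is_subfield D" and triv: "trivially_valued D" and t: "t \<noteq> 0" "w t = 1"
begin

text \<open>The nonzero coefficient \<open>d\<close> of lowest index \<open>k\<close> dominates:
  coefficients have value 0 and \<open>t\<close> has value 1, so every later term has greater
  value.\<close>

lemma poly_leading_form:
  assumes "\<And>i. coeff p i \<in> D" "p \<noteq> 0"
  shows "\<exists>k. \<exists>d\<in>D. d \<noteq> 0 \<and> value_ge 1 (poly p t / t ^ k - d)"
  using assms
proof (induction p)
  case (pCons a p)
  have c: "coeff p i \<in> D" for i using pCons.prems(1)[of "Suc i"] by simp
  have a: "a \<in> D" using pCons.prems(1)[of 0] by simp
  have vt: "value_ge 1 t" using t by (simp add: value_ge_def)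
  show ?case
  proof (cases "a = 0")
    case True
    then obtain k d where "d \<in> D" "d \<noteq> 0" "value_ge 1 (poly p t / t ^ k - d)"
      using pCons c by auto
    thus ?thesis using True t
      by (intro exI[of _ "Suc k"] bexI[of _ d]) auto
  next
    case False
    have "value_ge 0 (poly p t)"
      using c triv vt by (intro value_ge_poly trivially_valued_value_ge[OF triv] value_ge_mono[OF vt]) auto
    hence "value_ge 1 (t * poly p t)" by (rule value_ge_mult_right[OF vt])
    thus ?thesis using False a by (intro exI[of _ 0] bexI[of _ a]) auto
  qed
qed simp

lemma poly_nonzero:
  assumes "\<And>i. coeff p i \<in> D" "p \<noteq> 0"
  shows "poly p t \<noteq> 0"
proof
  assume "poly p t = 0"
  then obtain d where "d \<in> D" "d \<noteq> 0" "value_ge 1 (- d)"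
    using poly_leading_form[OF assms] by auto
  thus False using trivially_valued_eq_0[OF triv] by simp
qed

lemma coeff_add_mult_mem:
  assumes "\<And>i. coeff p i \<in> D" "\<And>i. coeff q i \<in> D"
  shows "coeff (p + q) i \<in> D" "coeff (p * q) i \<in> D"
  using assms by (auto simp: coeff_mult intro!: subfield_sum[OF D] is_subfieldD[OF D])

lemma rational_expressions_poly:
  assumes "\<And>i. coeff p i \<in> D"
  shows "poly p t \<in> rational_expressions D t"
  unfolding rational_expressions_def using assms
  by (intro CollectI exI[of _ p] exI[of _ 1]) (auto simp: coeff_pCons is_subfieldD[OF D] split: nat.splits)

lemma is_subfield_rational_expressions: "is_subfield (rational_expressions D t)"
  unfolding is_subfield_def
proof (intro conjI ballI)
  show "0 \<in> rational_expressions D t" "1 \<in> rational_expressions D t"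
    using rational_expressions_poly[of 0] rational_expressions_poly[of 1]
    by (auto simp: coeff_pCons is_subfieldD[OF D] split: nat.splits)
next
  fix x y assume "x \<in> rational_expressions D t" "y \<in> rational_expressions D t"
  then obtain p q p' q' where
    x: "x = poly p t / poly q t" "\<And>i. coeff p i \<in> D" "\<And>i. coeff q i \<in> D" "q \<noteq> 0" and
    y: "y = poly p' t / poly q' t" "\<And>i. coeff p' i \<in> D" "\<And>i. coeff q' i \<in> D" "q' \<noteq> 0"
    unfolding rational_expressions_def by blast
  note nz = poly_nonzero[OF x(3,4)] poly_nonzero[OF y(3,4)]
  have "x + y = poly (p * q' + p' * q) t / poly (q * q') t"
    using nz by (simp add: x(1) y(1) field_simps)
  moreover have "x * y = poly (p * p') t / poly (q * q') t"
    by (simp add: x(1) y(1))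
  moreover have "\<forall>i. coeff (p * q' + p' * q) i \<in> D" "\<forall>i. coeff (p * p') i \<in> D"
      "\<forall>i. coeff (q * q') i \<in> D" "q * q' \<noteq> 0"
    using x y by (simp_all add: coeff_add_mult_mem is_subfieldD[OF D])
  ultimately show "x + y \<in> rational_expressions D t" "x * y \<in> rational_expressions D t"
    unfolding rational_expressions_def by blast+
next
  fix x assume "x \<in> rational_expressions D t"
  then obtain p q where
    x: "x = poly p t / poly q t" "\<And>i. coeff p i \<in> D" "\<And>i. coeff q i \<in> D" "q \<noteq> 0"
    unfolding rational_expressions_def by blast
  have "- x = poly (- p) t / poly q t" "\<forall>i. coeff (- p) i \<in> D"
    using x by (simp_all add: is_subfieldD[OF D])
  thus "- x \<in> rational_expressions D t"
    using x(3,4) unfolding rational_expressions_def by blast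
  show "inverse x \<in> rational_expressions D t"
  proof (cases "p = 0")
    case True
    thus ?thesis using rational_expressions_poly[of 0] by (simp add: x(1) is_subfieldD[OF D])
  next
    case False
    have "inverse x = poly q t / poly p t" by (simp add: x(1))
    thus ?thesis using x False unfolding rational_expressions_def by blast
  qed
qed

text \<open>For an element of value 0 the leading forms of numerator and denominator carry the same
  power of \<open>t\<close>, and the residue is the quotient of the two leading coefficients, which
  lies in \<open>D\<close>.\<close>

lemma rational_expressions_residue:
  assumes "x \<in> rational_expressions D t" "value_ge 0 x"
  shows "\<exists>d\<in>D. value_ge 1 (x - d)"
proof (cases "value_ge 1 x")
  case True
  thus ?thesis using is_subfieldD(1)[OF D] by (intro bexI[of _ 0]) auto
next
  case False
  hence wx: "w x = 0" "x \<noteq> 0" using assms(2) by (auto simp: value_ge_def)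
  obtain p q where
    x: "x = poly p t / poly q t" "\<And>i. coeff p i \<in> D" "\<And>i. coeff q i \<in> D" "q \<noteq> 0"
    using assms(1) unfolding rational_expressions_def by blast
  have "p \<noteq> 0" using wx x by auto
  obtain k d where d: "d \<in> D" "d \<noteq> 0" "value_ge 1 (poly p t / t ^ k - d)"
    using poly_leading_form[OF x(2) \<open>p \<noteq> 0\<close>] by blast
  obtain l d' where d': "d' \<in> D" "d' \<noteq> 0" "value_ge 1 (poly q t / t ^ l - d')"
    using poly_leading_form[OF x(3,4)] by blast
  define a where "a = poly p t / t ^ k"
  define b where "b = poly q t / t ^ l"
  have wd: "w d = 0" "w d' = 0" using d d' triv by (auto simp: trivially_valued_def)
  have a: "a \<noteq> 0" "w a = 0"
    using w_eq_of_close[of d a] d wd by (auto simp: a_def value_ge_commute[of 1 d])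
  have b: "b \<noteq> 0" "w b = 0"
    using w_eq_of_close[of d' b] d' wd by (auto simp: b_def value_ge_commute[of 1 d'])
  have eq: "x = (t ^ k * a) / (t ^ l * b)" using t by (simp add: x(1) a_def b_def)
  hence "w x = (int k + w a) - (int l + w b)"
    using t a(1) b(1) by (simp add: w_divide w_mult w_power)
  hence "k = l" using wx a b by simp
  hence x_eq: "x = a / b" using eq t by simp
  have "a / b - d / d' = ((a - d) * d' + d * (d' - b)) * inverse (b * d')"
    using b d' by (simp add: field_simps)
  moreover have "value_ge 1 ((a - d) * d' + d * (d' - b))"
    using d d' wd unfolding a_def[symmetric] b_def[symmetric]
    by (intro value_ge_add value_ge_mult_left value_ge_mult_right)
       (auto simp: value_ge_commute[of 1 d'] value_ge_def[of 0])
  moreover have "value_ge 0 (inverse (b * d'))"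
    using b d' wd by (simp add: value_ge_def w_inverse w_mult)
  ultimately have "value_ge 1 (x - d / d')"
    unfolding x_eq by (simp add: value_ge_mult_right)
  thus ?thesis using d d' is_subfieldD(8)[OF D] by blast
qed

lemma is_subfield_laurent_field: "is_subfield (laurent_field D t)"
  unfolding laurent_field_def by (intro is_subfield_val_closure is_subfield_rational_expressions)

lemma val_closed_laurent_field: "val_closed (laurent_field D t)"
  unfolding laurent_field_def by (rule val_closed_val_closure)

lemma laurent_field_base: "D \<subseteq> laurent_field D t"
proof
  fix x assume "x \<in> D"
  hence "x \<in> rational_expressions D t"
    using rational_expressions_poly[of "[:x:]"] is_subfieldD(1)[OF D]
    by (simp add: coeff_pCons split: nat.splits)
  thus "x \<in> laurent_field D t" unfolding laurent_field_def using subset_val_closure by blast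
qed

lemma laurent_field_gen: "t \<in> laurent_field D t"
proof -
  have "t \<in> rational_expressions D t"
    using rational_expressions_poly[of "[:0, 1:]"] is_subfieldD(1,2)[OF D]
    by (simp add: coeff_pCons split: nat.splits)
  thus ?thesis unfolding laurent_field_def using subset_val_closure by blast
qed

text \<open>Passing to the closure adds no residues, because an approximation to precision 1 already
  has the same residue.\<close>

lemma laurent_field_residue:
  assumes "x \<in> laurent_field D t" "value_ge 0 x"
  shows "\<exists>d\<in>D. value_ge 1 (x - d)"
proof -
  obtain y where y: "y \<in> rational_expressions D t" "value_ge 1 (x - y)"
    using assms(1) by (auto simp: laurent_field_def val_closure_def)
  have "value_ge 0 (x - (x - y))"
    by (rule value_ge_diff[OF assms(2) value_ge_mono[OF y(2)]]) simp
  then obtain d where "d \<in> D" "value_ge 1 (y - d)"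
    using rational_expressions_residue[OF y(1)] by auto
  thus ?thesis using y(2) value_ge_trans by blast
qed

end


subsection \<open>Coefficient fields\<close>

text \<open>
  For a polynomial of least degree, the derivative at \<open>c\<close> is nonzero and lies in \<open>S\<close>, hence is a unit.
\<close>

lemma algebraic_imp_simple_root:
  assumes char0: "\<And>n. n > 0 \<Longrightarrow> of_nat n \<noteq> (0 :: 'c)"
    and S: "is_subfield S" "trivially_valued S" "c \<in> S"
    and D: "is_subfield D" "D \<subseteq> S" "D \<subseteq> E" and c: "algebraic_over D c"
  shows "simple_root_over E c"
proof -
  define P where "P = (\<lambda>p. p \<noteq> 0 \<and> (\<forall>i. coeff p i \<in> D) \<and> poly p c = 0)"
  have "\<exists>p. P p" using c by (auto simp: algebraic_over_def P_def)
  then obtain p where p: "P p" and least: "\<And>q. P q \<Longrightarrow> degree p \<le> degree q"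
    by (metis exists_least_lemma arg_min_nat_lemma)
  have deg: "degree p > 0"
  proof (rule ccontr)
    assume "\<not> degree p > 0"
    then obtain a where "p = [:a:]" using degree_eq_zeroE by blast
    thus False using p by (auto simp: P_def)
  qed
  \<comment> \<open>Characteristic 0 keeps the derivative nonzero. Being of smaller degree than
    \<open>p\<close>, it cannot vanish at \<open>c\<close> by minimality.\<close>
  have "coeff (pderiv p) (degree p - 1) = of_nat (degree p) * lead_coeff p"
    using deg by (simp add: coeff_pderiv)
  also have "\<dots> \<noteq> 0" using char0[OF deg] deg by (metis leading_coeff_0_iff mult_eq_0_iff degree_0 less_irrefl)
  finally have "pderiv p \<noteq> 0" by auto
  moreover have "degree (pderiv p) < degree p"
    by (rule le_less_trans[OF degree_le[of "degree p - 1"]])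
       (use deg in \<open>auto simp: coeff_pderiv coeff_eq_0\<close>)
  moreover have "\<forall>i. coeff (pderiv p) i \<in> D"
    using p subfield_coeff_pderiv[OF D(1)] by (auto simp: P_def)
  ultimately have nz: "poly (pderiv p) c \<noteq> 0"
    using least[of "pderiv p"] by (auto simp: P_def)
  have "coeff p i \<in> S" for i using p D by (auto simp: P_def)
  hence "poly (pderiv p) c \<in> S"
    using S by (intro subfield_poly[OF S(1)] subfield_coeff_pderiv[OF S(1)])
  hence "w (poly (pderiv p) c) = 0" using S(2) nz by (auto simp: trivially_valued_def)
  thus ?thesis unfolding simple_root_over_def
    using p nz D S by (auto simp: P_def intro!: trivially_valued_value_ge[OF S(2)])
qed

text \<open>Evaluation commutes with reduction modulo the maximal ideal; the Horner scheme splits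
  the difference into \<open>(x - y) * poly p x\<close> and \<open>y\<close> times the difference
  for the shorter polynomial. It is applied with \<open>f\<close> taking each element to the section
  of its residue.\<close>

lemma value_ge_poly_diff:
  assumes "\<And>i. value_ge 0 (coeff p i)" "\<And>i. value_ge 1 (coeff p i - f (coeff p i))" "f 0 = 0"
    and "value_ge 0 x" "value_ge 1 (x - y)" "value_ge 0 y"
  shows "value_ge 1 (poly p x - poly (map_poly f p) y)"
  using assms(1,2)
proof (induction p)
  case (pCons a p)
  have c: "value_ge 0 (coeff p i)" "value_ge 1 (coeff p i - f (coeff p i))" for i
    using pCons.prems(1)[of "Suc i"] pCons.prems(2)[of "Suc i"] by simp_all
  have "value_ge 1 (a - f a)" using pCons.prems(2)[of 0] by simp
  moreover have "value_ge 1 ((x - y) * poly p x + y * (poly p x - poly (map_poly f p) y))"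
    using value_ge_mult_right[OF assms(5) value_ge_poly[OF c(1) assms(4)]]
      value_ge_mult_left[OF assms(6) pCons.IH[OF c]]
    by (rule value_ge_add)
  ultimately have "value_ge 1 (a - f a + ((x - y) * poly p x + y * (poly p x - poly (map_poly f p) y)))"
    by (rule value_ge_add)
  thus ?case using assms(3) by (simp add: map_poly_pCons algebra_simps)
qed simp

end

locale valued_field_section = valued_field w for w :: "'c::field \<Rightarrow> int" +
  fixes K :: "'c set" and \<sigma> :: "'c set \<Rightarrow> 'c"
  assumes section_prop: "coefficient_section w K \<sigma>" and K: "is_subfield K"
begin

text \<open>The copy of the residue field that the section singles out inside the valuation
  ring.\<close>

definition coeff_field :: "'c set" where "coeff_field = \<sigma> ` residue_field w"

lemma section_residue:
  assumes "value_ge 0 x"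
  shows "\<sigma> (residue w x) \<in> coeff_field" "value_ge 1 (x - \<sigma> (residue w x))" "value_ge 0 (\<sigma> (residue w x))"
proof -
  have x: "residue w x \<in> residue_field w"
    using assms by (auto simp: residue_field_def valuation_ring_iff)
  thus "\<sigma> (residue w x) \<in> coeff_field" by (simp add: coeff_field_def)
  have "residue w (\<sigma> (residue w x)) = residue w x" "\<sigma> (residue w x) \<in> valuation_ring w"
    using section_prop x unfolding coefficient_section_def by blast+
  thus "value_ge 1 (x - \<sigma> (residue w x))" "value_ge 0 (\<sigma> (residue w x))"
    by (simp_all add: valuation_ring_iff value_ge_commute residue_eq_iff)
qed

lemma section_add:
  "value_ge 0 x \<Longrightarrow> value_ge 0 y \<Longrightarrow> \<sigma> (residue w (x + y)) = \<sigma> (residue w x) + \<sigma> (residue w y)"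
  and section_mult:
  "value_ge 0 x \<Longrightarrow> value_ge 0 y \<Longrightarrow> \<sigma> (residue w (x * y)) = \<sigma> (residue w x) * \<sigma> (residue w y)"
  and section_const: "c \<in> K \<Longrightarrow> \<sigma> (residue w c) = c"
  using section_prop by (simp_all add: coefficient_section_def valuation_ring_iff)

lemma coeff_field_value_ge: "d \<in> coeff_field \<Longrightarrow> value_ge 0 d"
  unfolding coeff_field_def residue_field_def by (auto simp: valuation_ring_iff intro: section_residue)

lemma section_coeff_field: "d \<in> coeff_field \<Longrightarrow> \<sigma> (residue w d) = d"
  using section_prop unfolding coeff_field_def coefficient_section_def by auto

lemma section_eqI: "d \<in> coeff_field \<Longrightarrow> value_ge 1 (x - d) \<Longrightarrow> \<sigma> (residue w x) = d"
  using residue_eq_iff section_coeff_field by metis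

lemma coeff_field_iff: "d \<in> coeff_field \<longleftrightarrow> value_ge 0 d \<and> \<sigma> (residue w d) = d"
  using coeff_field_value_ge section_coeff_field section_residue(1)[of d] by auto

text \<open>An element of positive value has the same residue as 0. Since \<sigma> recovers both an
  element of the coefficient field and 0 from their residues, that element is 0.\<close>

lemma trivially_valued_coeff_field: "trivially_valued coeff_field"
  unfolding trivially_valued_def
proof (intro ballI impI)
  fix d assume d: "d \<in> coeff_field" "d \<noteq> 0"
  have "\<not> value_ge 1 d"
  proof
    assume "value_ge 1 d"
    hence "residue w d = residue w 0" by (simp add: residue_eq_iff)
    hence "d = 0" using section_coeff_field[OF d(1)] section_const[OF is_subfieldD(1)[OF K]] by simp
    thus False using d by simp
  qed
  thus "w d = 0" using coeff_field_value_ge[OF d(1)] d by (auto simp: value_ge_def)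
qed

text \<open>A constant of negative value would have an inverse with residue 0, yet \<sigma> recovers
  this inverse from its residue.\<close>

lemma constants_subset_coeff_field: "K \<subseteq> coeff_field"
proof
  fix c assume c: "c \<in> K"
  have "value_ge 0 c"
  proof (rule ccontr)
    assume "\<not> value_ge 0 c"
    hence "c \<noteq> 0" "value_ge 1 (inverse c)" by (auto simp: value_ge_def w_inverse)
    hence "residue w (inverse c) = residue w 0" by (simp add: residue_eq_iff)
    thus False
      using section_const[of "inverse c"] section_const[of 0] is_subfieldD[OF K] c \<open>c \<noteq> 0\<close> by simp
  qed
  thus "c \<in> coeff_field" using c section_const by (simp add: coeff_field_iff)
qed

lemma is_subfield_coeff_field: "is_subfield coeff_field"
proof -
  have neg: "- x \<in> coeff_field" if "x \<in> coeff_field" for x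
  proof -
    \<comment> \<open>The section property speaks of sums and products, so negation is obtained as
      multiplication by the constant -1.\<close>
    have "\<sigma> (residue w (- 1 * x)) = \<sigma> (residue w (- 1)) * \<sigma> (residue w x)"
      using coeff_field_value_ge[OF that] by (intro section_mult) auto
    thus ?thesis
      using that section_const[of "- 1"] is_subfieldD[OF K] by (simp add: coeff_field_iff)
  qed
  have inv: "inverse x \<in> coeff_field" if x: "x \<in> coeff_field" for x
  proof (cases "x = 0")
    case False
    have wx: "w x = 0" using trivially_valued_coeff_field x False by (simp add: trivially_valued_def)
    hence v: "value_ge 0 (inverse x)" using False by (simp add: value_ge_def w_inverse)
    hence "\<sigma> (residue w (inverse x)) * x = \<sigma> (residue w (inverse x * x))"
      using section_mult[OF v coeff_field_value_ge[OF x]] section_coeff_field[OF x] by simp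
    also have "\<dots> = 1" using False section_const[OF is_subfieldD(2)[OF K]] by simp
    finally show ?thesis using False v by (simp add: coeff_field_iff field_simps)
  qed (use x in simp)
  have "0 \<in> coeff_field" "1 \<in> coeff_field" using constants_subset_coeff_field is_subfieldD[OF K] by auto
  moreover have "x + y \<in> coeff_field \<and> x * y \<in> coeff_field" if "x \<in> coeff_field" "y \<in> coeff_field" for x y
    using that by (auto simp: coeff_field_iff section_add section_mult value_ge_add value_ge_mult_left)
  ultimately show ?thesis using neg inv unfolding is_subfield_def by blast
qed

text \<open>Applying \<sigma> to the residues of the coefficients turns the polynomial of
  \<open>c\<close> into one over \<open>N\<close>. Its value at the section of the residue of
  \<open>c\<close> has positive value and lies in the coefficient field, so it is 0.\<close>

lemma simple_root_algebraic_residue: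
  assumes E: "\<And>x. x \<in> E \<Longrightarrow> value_ge 0 x \<Longrightarrow> \<exists>d\<in>N. value_ge 1 (x - d)"
    and N: "N \<subseteq> coeff_field" and c: "simple_root_over E c"
  shows "algebraic_over N (\<sigma> (residue w c))"
proof -
  obtain p where cE: "\<And>i. coeff p i \<in> E" and cR: "\<And>i. value_ge 0 (coeff p i)"
    and p: "poly p c = 0" "poly (pderiv p) c \<noteq> 0" "w (poly (pderiv p) c) = 0" and c: "value_ge 0 c"
    using c unfolding simple_root_over_def by blast
  define f where "f x = \<sigma> (residue w x)" for x
  have f0: "f 0 = 0" using section_const[OF is_subfieldD(1)[OF K]] by (simp add: f_def)
  have fN: "f x \<in> N" if "x \<in> E" "value_ge 0 x" for x
    using E[OF that] N section_eqI unfolding f_def by fastforce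
  define q where "q = map_poly f p"
  have coeff_q: "coeff q i = f (coeff p i)" for i by (simp add: q_def coeff_map_poly f0)
  hence qN: "coeff q i \<in> N" for i using fN[OF cE cR] by simp
  have diff: "value_ge 1 (coeff p i - f (coeff p i))" for i
    unfolding f_def by (rule section_residue[OF cR])
  have fc: "value_ge 1 (c - f c)" "value_ge 0 (f c)" "f c \<in> coeff_field"
    using section_residue[OF c] by (simp_all add: f_def)
  have "value_ge 1 (poly p c - poly q (f c))"
    unfolding q_def using cR diff f0 c fc by (intro value_ge_poly_diff)
  hence "value_ge 1 (poly q (f c))" using p(1) by simp
  moreover have "poly q (f c) \<in> coeff_field"
    using qN N fc by (intro subfield_poly[OF is_subfield_coeff_field]) auto
  ultimately have "poly q (f c) = 0" by (intro trivially_valued_eq_0[OF trivially_valued_coeff_field])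
  \<comment> \<open>If the reduction were zero, all coefficients of \<open>p\<close> would have
    positive value, and with them the derivative at \<open>c\<close>, which is a unit.\<close>
  moreover have "q \<noteq> 0"
  proof
    assume "q = 0"
    hence "value_ge 1 (coeff p i)" for i using diff[of i] coeff_q[of i] by simp
    hence "value_ge 1 (coeff (pderiv p) i * c ^ i)" for i
      unfolding coeff_pderiv
      by (intro value_ge_mult_right[OF value_ge_mult_left] value_ge_of_nat value_ge_power[OF c])
    hence "value_ge 1 (poly (pderiv p) c)" unfolding poly_altdef by (intro value_ge_sum)
    thus False using p by (simp add: value_ge_def)
  qed
  ultimately show ?thesis using qN unfolding algebraic_over_def f_def by blast
qed

end


section \<open>Power series and the completion\<close>

lemma mps_coeff_sum: "mps_coeff (\<Sum>i\<in>A. f i) m = (\<Sum>i\<in>A. mps_coeff (f i) m)"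
  by (induction A rule: infinite_finite_induct) (simp_all add: zero_mps.rep_eq plus_mps.rep_eq)

lemma mps_coeff_const_mult: "mps_coeff (mps_const c * g) m = c * mps_coeff g m"
proof -
  have "mps_coeff (mps_const c * g) m =
      (\<Sum>b\<in>{..m}. if b = (\<lambda>_. 0) then c * mps_coeff g (\<lambda>j. m j - b j) else 0)"
    unfolding times_mps.rep_eq mps_const.rep_eq by (intro sum.cong) auto
  also have "\<dots> = c * mps_coeff g m"
    by (subst sum.delta) (auto simp: le_fun_def)
  finally show ?thesis .
qed

lemma mps_const_0: "mps_const 0 = 0"
  and mps_const_1: "mps_const 1 = 1"
  and mps_const_add: "mps_const (a + b) = mps_const a + mps_const b"
  and mps_const_uminus: "mps_const (- a) = - mps_const a"
  by (transfer; auto simp: fun_eq_iff)+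

lemma mps_const_mult: "mps_const (a * b) = mps_const a * mps_const b"
  unfolding mps_eq_iff mps_coeff_const_mult by (simp add: mps_const.rep_eq)

lemma mps_coeff_var_mult:
  "mps_coeff (mps_var i * g) a = (if a i = 0 then 0 else mps_coeff g (a(i := a i - 1)))"
proof -
  define d where "d = (\<lambda>j. if j = i then 1 else 0 :: nat)"
  have "mps_coeff (mps_var i * g) a =
      (\<Sum>b\<in>{..a}. if b = d then mps_coeff g (\<lambda>j. a j - b j) else 0)"
    unfolding times_mps.rep_eq mps_var.rep_eq d_def by (intro sum.cong) auto
  also have "\<dots> = (if d \<le> a then mps_coeff g (\<lambda>j. a j - d j) else 0)"
    by (subst sum.delta) auto
  also have "d \<le> a \<longleftrightarrow> a i \<noteq> 0" by (auto simp: d_def le_fun_def)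
  also have "(\<lambda>j. a j - d j) = a(i := a i - 1)" by (auto simp: d_def)
  finally show ?thesis by simp
qed

text \<open>
  Every monomial other than 1 is divided by one of its variables, chosen by \<open>pick\<close>; the
  coefficient of \<open>f\<close> at it is passed on to the cofactor of that variable.
\<close>

lemma mps_var_ideal_iff:
  fixes f :: "('a::comm_ring_1, 'n::finite) mps"
  shows "f \<in> mps_var_ideal \<longleftrightarrow> mps_coeff f (\<lambda>_. 0) = 0"
proof
  assume "f \<in> mps_var_ideal"
  thus "mps_coeff f (\<lambda>_. 0) = 0"
    by (auto simp: mps_var_ideal_def mps_coeff_sum mps_coeff_var_mult)
next
  assume f: "mps_coeff f (\<lambda>_. 0) = 0"
  define pick :: "('n \<Rightarrow> nat) \<Rightarrow> 'n" where "pick a = (SOME i. a i \<noteq> 0)" for a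
  define g where
    "g i = Abs_mps (\<lambda>b. if pick (b(i := b i + 1)) = i then mps_coeff f (b(i := b i + 1)) else 0)"
    for i
  have coeff_g: "mps_coeff (g i) b =
      (if pick (b(i := b i + 1)) = i then mps_coeff f (b(i := b i + 1)) else 0)" for i b
    by (simp add: g_def Abs_mps_inverse)
  have "mps_coeff f a = mps_coeff (\<Sum>i\<in>UNIV. mps_var i * g i) a" for a
  proof (cases "a = (\<lambda>_. 0)")
    case True
    thus ?thesis by (simp add: f mps_coeff_sum mps_coeff_var_mult)
  next
    case False
    hence "\<exists>i. a i \<noteq> 0" by auto
    hence pick: "a (pick a) \<noteq> 0" unfolding pick_def by (rule someI_ex)
    have "mps_coeff (\<Sum>i\<in>UNIV. mps_var i * g i) a = (\<Sum>i\<in>UNIV. if i = pick a then mps_coeff f a else 0)"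
      unfolding mps_coeff_sum mps_coeff_var_mult coeff_g using pick by (intro sum.cong) auto
    thus ?thesis by simp
  qed
  hence "f = (\<Sum>i\<in>UNIV. mps_var i * g i)" by (simp add: mps_eq_iff)
  thus "f \<in> mps_var_ideal" unfolding mps_var_ideal_def by blast
qed

lemma mps_var_in_ideal: "mps_var i \<in> mps_var_ideal"
proof -
  have "(\<lambda>j. if j = i then 1 else 0 :: nat) \<noteq> (\<lambda>_. 0)" by (metis zero_neq_one)
  thus ?thesis unfolding mps_var_ideal_iff mps_var.rep_eq by (auto simp: fun_eq_iff)
qed

text \<open>Applied repeatedly to the cofactors, this approximates a power series by polynomials in
  the variables to any order.\<close>

lemma mps_decompose:
  "\<exists>g. f = mps_const (mps_coeff f (\<lambda>_. 0)) + (\<Sum>i\<in>UNIV. mps_var i * g i)"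
proof -
  have "f - mps_const (mps_coeff f (\<lambda>_. 0)) \<in> mps_var_ideal"
    by (simp add: mps_var_ideal_iff minus_mps.rep_eq mps_const.rep_eq)
  thus ?thesis unfolding mps_var_ideal_def by (auto simp: algebra_simps)
qed

lemma mps_var_nonzero: "mps_var i \<noteq> (0 :: ('a::comm_ring_1, 'n::finite) mps)"
  by (simp add: mps_eq_iff mps_var.rep_eq zero_mps.rep_eq)

section \<open>The embedding into the completion and the field of constants\<close>

locale power_series_completion =
  fixes v :: "('k::{alg_closed_field, field_char_0}, 'n::finite) mps fract \<Rightarrow> int"
    and \<iota> :: "('k, 'n) mps fract \<Rightarrow> 'c::field" and w :: "'c \<Rightarrow> int"
  assumes centered: "centered_valuation v" and completion: "is_completion v \<iota> w"

sublocale power_series_completion \<subseteq> valued_field w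
  by unfold_locales (use completion in \<open>simp add: is_completion_def\<close>)

context power_series_completion
begin

definition constants :: "'c set" where
  "constants = range (\<lambda>c. \<iota> (to_fract (mps_const c)))"

definition const :: "'k \<Rightarrow> 'c" where
  "const c = \<iota> (to_fract (mps_const c))"

lemma constants_eq: "constants = range const"
  by (simp add: constants_def const_def)

lemma \<iota>_1: "\<iota> 1 = 1" and \<iota>_add: "\<iota> (x + y) = \<iota> x + \<iota> y"
  and \<iota>_mult: "\<iota> (x * y) = \<iota> x * \<iota> y"
  and w_\<iota>: "x \<noteq> 0 \<Longrightarrow> w (\<iota> x) = v x"
  using completion by (simp_all add: is_completion_def)

lemma \<iota>_dense: "\<exists>x. value_ge N (y - \<iota> x)"
  using completion unfolding is_completion_def value_ge_def by (metis right_minus_eq)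

lemma \<iota>_0: "\<iota> 0 = 0"
  by (metis \<iota>_add add_0 add_cancel_right_right)

lemma \<iota>_uminus: "\<iota> (- x) = - \<iota> x"
  using \<iota>_add[of x "- x"] by (simp add: \<iota>_0 eq_neg_iff_add_eq_0 add.commute)

lemma \<iota>_diff: "\<iota> (x - y) = \<iota> x - \<iota> y"
  using \<iota>_add[of x "- y"] by (simp add: \<iota>_uminus)

lemma \<iota>_eq_0_iff: "\<iota> x = 0 \<longleftrightarrow> x = 0"
proof
  assume "\<iota> x = 0"
  thus "x = 0" using \<iota>_mult[of x "inverse x"] \<iota>_1 by (cases "x = 0") auto
qed (simp add: \<iota>_0)

lemma \<iota>_inverse: "\<iota> (inverse x) = inverse (\<iota> x)"
proof (cases "x = 0")
  case False
  have "\<iota> (inverse x) * \<iota> x = 1" using False by (simp add: \<iota>_mult[symmetric] \<iota>_1)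
  thus ?thesis by (metis inverse_unique mult.commute)
qed (simp add: \<iota>_0)

lemma \<iota>_divide: "\<iota> (x / y) = \<iota> x / \<iota> y"
  by (simp add: divide_inverse \<iota>_mult \<iota>_inverse)

lemma \<iota>_sum: "\<iota> (\<Sum>i\<in>A. f i) = (\<Sum>i\<in>A. \<iota> (f i))"
  by (induction A rule: infinite_finite_induct) (simp_all add: \<iota>_0 \<iota>_add)

lemma value_ge_\<iota>:
  "x \<in> valuation_ring v \<longleftrightarrow> value_ge 0 (\<iota> x)" "x \<in> valuation_ideal v \<longleftrightarrow> value_ge 1 (\<iota> x)"
  by (cases "x = 0"; auto simp: valuation_ring_def valuation_ideal_def value_ge_def \<iota>_eq_0_iff w_\<iota>)+

lemma const_simps:
  "const 0 = 0" "const 1 = 1" "const (a + b) = const a + const b" "const (a * b) = const a * const b"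
  "const (- a) = - const a"
  by (simp_all add: const_def mps_const_0 mps_const_1 mps_const_add mps_const_mult mps_const_uminus
      to_fract_add to_fract_mult to_fract_uminus \<iota>_0 \<iota>_1 \<iota>_add \<iota>_mult \<iota>_uminus)

lemma const_diff: "const (a - b) = const a - const b"
  using const_simps(3)[of a "- b"] by (simp add: const_simps(5))

lemma const_eq_0_iff: "const a = 0 \<longleftrightarrow> a = 0"
  using const_simps(4)[of a "inverse a"] const_simps(1,2) by (cases "a = 0") auto

lemma const_inverse: "const (inverse a) = inverse (const a)"
proof (cases "a = 0")
  case False
  have "const (inverse a) * const a = 1" using False by (simp flip: const_simps)
  thus ?thesis by (metis inverse_unique mult.commute)
qed (simp add: const_simps)

lemma is_subfield_constants: "is_subfield constants"
  unfolding is_subfield_def constants_eq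
proof (intro conjI ballI)
  show "0 \<in> range const" "1 \<in> range const" using const_simps(1,2) by (metis rangeI)+
qed (auto simp flip: const_simps const_inverse)

lemma const_of_nat: "const (of_nat n) = of_nat n"
  by (induction n) (simp_all add: const_simps)

lemma of_nat_nonzero: "n > 0 \<Longrightarrow> of_nat n \<noteq> (0 :: 'c)"
  using const_eq_0_iff[of "of_nat n"] by (simp add: const_of_nat)

text \<open>Over the algebraically closed field a linear factor splits off. The factorisation is
  carried over by \<open>const\<close>, so \<open>x\<close> is the image of that root or a root of
  the image of the quotient.\<close>

lemma root_of_constant_poly:
  assumes "q \<noteq> 0" "poly (map_poly const q) x = 0"
  shows "x \<in> constants"
  using assms
proof (induction "degree q" arbitrary: q rule: less_induct)
  case less
  have "degree q > 0"
  proof (rule ccontr)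
    assume "\<not> degree q > 0"
    then obtain a where "q = [:a:]" using degree_eq_zeroE by blast
    thus False using less.prems by (simp add: map_poly_pCons const_eq_0_iff)
  qed
  then obtain a where a: "poly q a = 0" using alg_closed_imp_poly_has_root by blast
  define r where "r = synthetic_div q a"
  have q: "q = [:- a, 1:] * r"
    using synthetic_div_correct'[of a q] a by (simp add: r_def)
  have "map_poly const q = [:- const a, 1:] * map_poly const r"
  proof (rule poly_eqI)
    fix j
    show "coeff (map_poly const q) j = coeff ([:- const a, 1:] * map_poly const r) j"
      unfolding q by (cases j) (simp_all add: coeff_map_poly const_simps const_diff)
  qed
  with less.prems(2) have "poly [:- const a, 1:] x = 0 \<or> poly (map_poly const r) x = 0"
    by (simp only: poly_mult mult_eq_0_iff)
  hence "x = const a \<or> poly (map_poly const r) x = 0" by auto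
  moreover have "degree r < degree q"
    using \<open>degree q > 0\<close> by (simp add: r_def degree_synthetic_div)
  moreover have "r \<noteq> 0" using q less.prems(1) by auto
  ultimately show ?case using less.hyps by (auto simp: constants_eq)
qed

text \<open>Choosing preimages of the coefficients under \<open>const\<close> pulls the polynomial
  back to the algebraically closed field.\<close>

lemma constants_algebraically_closed:
  assumes "algebraic_over constants x"
  shows "x \<in> constants"
proof -
  obtain p where p: "p \<noteq> 0" "\<And>i. coeff p i \<in> constants" "poly p x = 0"
    using assms unfolding algebraic_over_def by blast
  obtain inv_const where ic: "\<And>y. y \<in> constants \<Longrightarrow> const (inv_const y) = y"
    unfolding constants_eq by (metis f_inv_into_f)
  have "inv_const 0 = 0"
    using ic[of 0] is_subfieldD(1)[OF is_subfield_constants] by (simp add: const_eq_0_iff)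
  hence eq: "map_poly const (map_poly inv_const p) = p"
    using ic p(2) by (intro poly_eqI) (simp add: coeff_map_poly const_simps)
  moreover from eq p(1) have "map_poly inv_const p \<noteq> 0" by auto
  ultimately show ?thesis using root_of_constant_poly[of "map_poly inv_const p"] p(3) by simp
qed

lemma value_ge_series: "value_ge 0 (\<iota> (to_fract f))"
  using centered by (auto simp: centered_valuation_def value_ge_\<iota>(1)[symmetric])

lemma value_ge_var: "value_ge 1 (\<iota> (to_fract (mps_var i)))"
  using centered mps_var_in_ideal[where ?'a = 'k and i = i]
  by (auto simp: centered_valuation_def value_ge_\<iota>(2)[symmetric])

lemma var_nonzero: "\<iota> (to_fract (mps_var i)) \<noteq> 0"
  by (simp add: \<iota>_eq_0_iff mps_var_nonzero)

text \<open>Each decomposition into constant term and multiples of variables gains 1 in precision,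
  because the variables have positive value. So power series are limits of elements of
  \<open>E\<close>, and their quotients follow.\<close>

lemma image_subset_closed_field:
  assumes E: "is_subfield E" "val_closed E" and K: "constants \<subseteq> E"
    and vars: "\<And>i. \<iota> (to_fract (mps_var i)) \<in> E"
  shows "\<iota> x \<in> E"
proof -
  have approx: "\<exists>y\<in>E. value_ge (int N) (\<iota> (to_fract f) - y)" for N f
  proof (induction N arbitrary: f)
    case 0
    show ?case using value_ge_series is_subfieldD(1)[OF E(1)] by (intro bexI[of _ 0]) auto
  next
    case (Suc N)
    obtain g where f: "f = mps_const (mps_coeff f (\<lambda>_. 0)) + (\<Sum>i\<in>UNIV. mps_var i * g i)"
      using mps_decompose[of f] by blast
    obtain y where y: "\<And>i. y i \<in> E" "\<And>i. value_ge (int N) (\<iota> (to_fract (g i)) - y i)"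
      using Suc[of "g _"] by metis
    let ?X = "\<lambda>i. \<iota> (to_fract (mps_var i))"
    define z where "z = const (mps_coeff f (\<lambda>_. 0)) + (\<Sum>i\<in>UNIV. ?X i * y i)"
    have "z \<in> E"
      unfolding z_def using K vars y(1)
      by (intro is_subfieldD(3)[OF E(1)] subfield_sum[OF E(1)] is_subfieldD(4)[OF E(1)])
         (auto simp: constants_eq)
    moreover have "\<iota> (to_fract f) = const (mps_coeff f (\<lambda>_. 0)) + (\<Sum>i\<in>UNIV. ?X i * \<iota> (to_fract (g i)))"
      by (subst f) (simp add: const_def to_fract_add to_fract_mult to_fract_sum \<iota>_add \<iota>_sum \<iota>_mult)
    hence "\<iota> (to_fract f) - z = (\<Sum>i\<in>UNIV. ?X i * (\<iota> (to_fract (g i)) - y i))"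
      by (simp add: z_def sum_subtractf algebra_simps)
    moreover have "value_ge (1 + int N) (\<Sum>i\<in>UNIV. ?X i * (\<iota> (to_fract (g i)) - y i))"
      by (intro value_ge_sum value_ge_mult value_ge_var y(2))
    ultimately show ?case by (intro bexI[of _ z]) simp_all
  qed
  have series: "\<iota> (to_fract f) \<in> E" for f
  proof (rule val_closedD[OF E(2)])
    fix N
    obtain y where "y \<in> E" "value_ge (int (nat N)) (\<iota> (to_fract f) - y)" using approx by blast
    moreover from this(2) have "value_ge N (\<iota> (to_fract f) - y)" by (rule value_ge_mono) simp
    ultimately show "\<exists>y\<in>E. value_ge N (\<iota> (to_fract f) - y)" by blast
  qed
  obtain a b where "x = Fract a b" by (cases x)
  thus ?thesis by (simp add: Fract_conv_to_fract \<iota>_divide series is_subfieldD[OF E(1)])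
qed

lemma residue_map_residue: "residue_map \<iota> w (residue v x) = residue w (\<iota> x)"
proof -
  have "residue w (\<iota> y) = residue w (\<iota> x)" if "y \<in> residue v x" for y
    using that by (simp add: residue_def[of v] value_ge_\<iota> \<iota>_diff residue_eq_iff)
  moreover have "x \<in> residue v x" by (simp add: residue_def valuation_ideal_def)
  ultimately show ?thesis unfolding residue_map_def by blast
qed

lemma residue_v_eq_iff: "residue v x = residue v y \<longleftrightarrow> value_ge 1 (\<iota> x - \<iota> y)"
proof
  assume "residue v x = residue v y"
  hence "residue w (\<iota> x) = residue w (\<iota> y)" by (metis residue_map_residue)
  thus "value_ge 1 (\<iota> x - \<iota> y)" by (simp add: residue_eq_iff)
next
  assume xy: "value_ge 1 (\<iota> x - \<iota> y)"
  show "residue v x = residue v y"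
    unfolding residue_def value_ge_\<iota> \<iota>_diff
    using xy by (auto intro: value_ge_trans simp: value_ge_commute[of _ "\<iota> y"])
qed

text \<open>Injectivity holds because the section separates residues, surjectivity because the image
  of \<iota> is dense. It remains to supply \<open>res\<close>, that every residue coming from
  \<iota> has a representative in \<open>D\<close>.\<close>

lemma residue_field_isoI:
  assumes sec: "coefficient_section w constants \<sigma>"
    and D: "is_subfield D" "D \<subseteq> \<sigma> ` residue_field w"
    and res: "\<And>x. value_ge 0 (\<iota> x) \<Longrightarrow> \<exists>d\<in>D. value_ge 1 (\<iota> x - d)"
  shows "residue_field_iso v (\<lambda>A. \<sigma> (residue_map \<iota> w A)) D"
proof -
  interpret valued_field_section w constants \<sigma>
    by unfold_locales (use sec is_subfield_constants in auto)
  have DS: "D \<subseteq> coeff_field" using D(2) by (simp add: coeff_field_def)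
  show ?thesis
    unfolding residue_field_iso_def
  proof (intro conjI ballI)
    show "\<sigma> (residue_map \<iota> w (residue v 1)) = 1"
      using section_const[OF is_subfieldD(2)[OF is_subfield_constants]]
      by (simp add: residue_map_residue \<iota>_1)
    show "bij_betw (\<lambda>A. \<sigma> (residue_map \<iota> w A)) (residue_field v) D"
    proof (rule bij_betw_imageI)
      show "inj_on (\<lambda>A. \<sigma> (residue_map \<iota> w A)) (residue_field v)"
      proof (rule inj_onI)
        fix A B assume AB: "A \<in> residue_field v" "B \<in> residue_field v"
          and eq: "\<sigma> (residue_map \<iota> w A) = \<sigma> (residue_map \<iota> w B)"
        obtain x y where x: "x \<in> valuation_ring v" "A = residue v x"
          and y: "y \<in> valuation_ring v" "B = residue v y"
          using AB by (auto simp: residue_field_def)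
        have "value_ge 1 (\<iota> x - \<sigma> (residue w (\<iota> x)))" "value_ge 1 (\<iota> y - \<sigma> (residue w (\<iota> x)))"
          using x y eq section_residue(2)[of "\<iota> x"] section_residue(2)[of "\<iota> y"]
          by (simp_all add: value_ge_\<iota> residue_map_residue)
        hence "value_ge 1 (\<iota> x - \<iota> y)" by (metis value_ge_trans value_ge_commute)
        thus "A = B" by (simp add: x y residue_v_eq_iff)
      qed
      show "(\<lambda>A. \<sigma> (residue_map \<iota> w A)) ` residue_field v = D"
      proof (intro equalityI subsetI)
        fix d assume "d \<in> (\<lambda>A. \<sigma> (residue_map \<iota> w A)) ` residue_field v"
        then obtain x where x: "value_ge 0 (\<iota> x)" "d = \<sigma> (residue w (\<iota> x))"
          by (auto simp: residue_field_def residue_map_residue value_ge_\<iota>)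
        obtain d' where d': "d' \<in> D" "value_ge 1 (\<iota> x - d')" using res[OF x(1)] by blast
        hence "d = d'" using x section_eqI DS by blast
        thus "d \<in> D" using d' by simp
      next
        fix d assume d: "d \<in> D"
        obtain x where x: "value_ge 1 (d - \<iota> x)" using \<iota>_dense by blast
        have "value_ge 0 (\<iota> x)"
          using value_ge_diff[OF coeff_field_value_ge[of d] value_ge_mono[OF x, of 0]] d DS by auto
        moreover have "\<sigma> (residue w (\<iota> x)) = d"
          using x d DS by (intro section_eqI) (auto simp: value_ge_commute)
        ultimately show "d \<in> (\<lambda>A. \<sigma> (residue_map \<iota> w A)) ` residue_field v"
          by (auto simp: residue_field_def residue_map_residue value_ge_\<iota> intro!: image_eqI[of _ _ "residue v x"])
      qed
    qed
  qed (simp_all add: D value_ge_\<iota> residue_map_residue \<iota>_add \<iota>_mult section_add section_mult)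
qed

end


section \<open>Rounds of the construction\<close>

lemma remainder_eq: "y = remainder y t c s + (\<Sum>j=1..s. c j * t ^ j)"
  by (simp add: remainder_def)

lemma subfield_of_remainder:
  assumes E: "is_subfield E" and "remainder y t c s \<in> E" "t \<in> E" "\<And>j. j \<in> {1..s} \<Longrightarrow> c j \<in> E"
  shows "y \<in> E"
  by (subst remainder_eq[of y t c s])
     (intro is_subfieldD(3,4)[OF E] subfield_sum[OF E] subfield_power[OF E] assms)

lemma (in valued_field_section) expands_mem_coeff_field:
  assumes "expands w \<sigma> y t c s" "j \<in> {1..s}"
  shows "c j \<in> coeff_field"
proof -
  have "remainder y t c (j - 1) / t ^ j \<in> valuation_ring w"
    and eq: "c j = \<sigma> (residue w (remainder y t c (j - 1) / t ^ j))"
    using assms unfolding expands_def by blast+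
  from this(1) have "\<sigma> (residue w (remainder y t c (j - 1) / t ^ j)) \<in> coeff_field"
    unfolding valuation_ring_iff by (rule section_residue)
  thus ?thesis by (simp only: eq[symmetric])
qed

lemma construction_round_section:
  "construction_round w K n Y \<sigma> p T s U u \<Delta> Y' \<Longrightarrow> coefficient_section w K \<sigma>"
  unfolding construction_round_def by blast

text \<open>The bound \<open>p\<close> is \<open>n\<close> for the final round and
  \<open>i - 1\<close> for a round that is closed by the variable of index \<open>i\<close>.\<close>

locale fixed_round = valued_field_section w K \<sigma>
  for w :: "'c::field \<Rightarrow> int" and K \<sigma> +
  fixes n p :: nat and Y :: "nat \<Rightarrow> 'c" and T :: "nat set" and s :: "nat \<Rightarrow> nat"
    and U :: "nat \<Rightarrow> nat \<Rightarrow> 'c" and u :: "nat \<Rightarrow> 'c" and \<Delta> :: "nat \<Rightarrow> 'c set" and Y' :: "nat \<Rightarrow> 'c"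
  assumes round: "construction_round w K n Y \<sigma> p T s U u \<Delta> Y'"
    and bounds: "2 \<le> n" "p \<le> n" and nonzero: "\<And>i. i \<in> {1..n} \<Longrightarrow> Y i \<noteq> 0"
begin

text \<open>One index set for the finite list of situation (2) and the infinite list of situation
  (3), so that both can be handled together.\<close>

definition coeff_indices :: "nat \<Rightarrow> nat set" where
  "coeff_indices i = (if i \<in> T then {1..s i} else {1..})"

lemma round_facts:
  shows "i \<in> {1..n} \<Longrightarrow> w (Y i) = w (Y 1)"
    and "residue w (Y 2 / Y 1) \<notin> residue w ` K"
    and "\<sigma> (residue w (Y 2 / Y 1)) = Y 2 / Y 1" and "u 2 = Y 2 / Y 1" and "\<Delta> 2 = adjoin K {u 2}"
    and "i \<notin> {3..p} \<Longrightarrow> Y' i = Y i"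
  using round unfolding construction_round_def by blast+

lemma Y1_nonzero: "Y 1 \<noteq> 0" and w_Y2: "w (Y 2) = w (Y 1)"
  using nonzero[of 1] bounds round_facts(1)[of 2] by auto

lemma u2: "u 2 = Y 2 / Y 1" "u 2 \<in> coeff_field"
proof -
  show eq: "u 2 = Y 2 / Y 1" by (rule round_facts)
  have "Y 2 \<noteq> 0" using nonzero bounds by simp
  hence "value_ge 0 (u 2)" using Y1_nonzero w_Y2 by (simp add: eq w_divide value_ge_def)
  moreover have "\<sigma> (residue w (u 2)) = u 2" unfolding eq by (rule round_facts)
  ultimately show "u 2 \<in> coeff_field" by (simp add: coeff_field_iff)
qed

text \<open>The normalisation of \<sigma> on \<open>u i\<close> yields an exact equation for the
  remainder rather than a congruence, so \<open>u i\<close> and the remainder determine each other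
  over \<open>Y 1\<close>.\<close>

lemma round_situation2:
  assumes "i \<in> {3..p}" "i \<in> T"
  obtains r where "expands w \<sigma> (Y i) (Y 1) (U i) (s i)"
    "\<And>j. j \<in> coeff_indices i \<Longrightarrow> algebraic_over (\<Delta> (i - 1)) (U i j)"
    "remainder (Y i) (Y 1) (U i) (s i) \<noteq> 0"
    "\<not> algebraic_over (\<Delta> (i - 1)) (u i)" "u i \<in> coeff_field"
    "remainder (Y i) (Y 1) (U i) (s i) = u i * Y 1 ^ r"
    "Y' i = remainder (Y i) (Y 1) (U i) (s i) / Y 1 ^ (r - 1)"
proof -
  have "situation2 w \<sigma> (\<Delta> (i - 1)) (Y 1) (Y i) (U i) (s i) (u i) (Y' i)"
    using round assms unfolding construction_round_def by meson
  then obtain r where r: "expands w \<sigma> (Y i) (Y 1) (U i) (s i)"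
    "\<forall>j\<in>{1..s i}. algebraic_over (\<Delta> (i - 1)) (U i j)"
    "remainder (Y i) (Y 1) (U i) (s i) \<noteq> 0"
    "w (remainder (Y i) (Y 1) (U i) (s i)) = int r * w (Y 1)"
    "u i = \<sigma> (residue w (remainder (Y i) (Y 1) (U i) (s i) / Y 1 ^ r))"
    "\<not> algebraic_over (\<Delta> (i - 1)) (u i)"
    "u i = remainder (Y i) (Y 1) (U i) (s i) / Y 1 ^ r"
    "Y' i = remainder (Y i) (Y 1) (U i) (s i) / Y 1 ^ (r - 1)"
    unfolding situation2_def by blast
  have "value_ge 0 (remainder (Y i) (Y 1) (U i) (s i) / Y 1 ^ r)"
    using r(3,4) Y1_nonzero by (simp add: value_ge_def w_divide w_power)
  hence "u i \<in> coeff_field" unfolding r(5) by (rule section_residue)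
  moreover have "remainder (Y i) (Y 1) (U i) (s i) = u i * Y 1 ^ r"
    unfolding r(7) using Y1_nonzero by (intro nonzero_divide_eq_eq[THEN iffD1]) simp_all
  moreover have "algebraic_over (\<Delta> (i - 1)) (U i j)" if "j \<in> coeff_indices i" for j
    using r(2) that assms(2) by (simp add: coeff_indices_def)
  ultimately show thesis using that r(1,3,6,8) by blast
qed

lemma round_situation3:
  assumes "i \<in> {3..p}" "i \<notin> T"
  shows "expands w \<sigma> (Y i) (Y 1) (U i) k" "j \<in> coeff_indices i \<Longrightarrow> algebraic_over (\<Delta> (i - 1)) (U i j)"
    "Y' i = Y i"
proof -
  have *: "situation3 w \<sigma> (\<Delta> (i - 1)) (Y 1) (Y i) (U i) \<and> Y' i = Y i"
    using round assms unfolding construction_round_def by meson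
  thus "expands w \<sigma> (Y i) (Y 1) (U i) k" "Y' i = Y i" by (simp_all add: situation3_def)
  show "j \<in> coeff_indices i \<Longrightarrow> algebraic_over (\<Delta> (i - 1)) (U i j)"
    using * assms by (simp add: situation3_def coeff_indices_def)
qed

lemma coefficients:
  assumes i: "i \<in> {3..p}" and j: "j \<in> coeff_indices i"
  shows "algebraic_over (\<Delta> (i - 1)) (U i j)" "U i j \<in> coeff_field"
proof -
  show "algebraic_over (\<Delta> (i - 1)) (U i j)"
    using round_situation2[OF i] round_situation3(2)[OF i] j by metis
  show "U i j \<in> coeff_field"
  proof (cases "i \<in> T")
    case True
    obtain r where "expands w \<sigma> (Y i) (Y 1) (U i) (s i)" using round_situation2[OF i True] by metis
    thus ?thesis by (rule expands_mem_coeff_field) (use j True in \<open>simp add: coeff_indices_def\<close>)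
  next
    case False
    show ?thesis by (rule expands_mem_coeff_field[OF round_situation3(1)[OF i False, of j]])
      (use j False in \<open>simp add: coeff_indices_def\<close>)
  qed
qed

lemma \<Delta>_2: "\<Delta> 2 = adjoin K {u 2}"
  by (rule round_facts)

lemma \<Delta>_step:
  assumes "i \<in> {3..p}"
  shows "\<Delta> i = adjoin (\<Delta> (i - 1)) (U i ` coeff_indices i \<union> (if i \<in> T then {u i} else {}))"
proof (cases "i \<in> T")
  case True
  hence "\<Delta> i = adjoin (\<Delta> (i - 1)) (U i ` {1..s i} \<union> {u i})"
    using round assms unfolding construction_round_def by meson
  thus ?thesis using True by (simp add: coeff_indices_def)
next
  case False
  hence "\<Delta> i = adjoin (\<Delta> (i - 1)) (U i ` {1..})"
    using round assms unfolding construction_round_def by meson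
  thus ?thesis using False by (simp add: coeff_indices_def)
qed

lemma is_subfield_\<Delta>: "i = 2 \<or> i \<in> {3..p} \<Longrightarrow> is_subfield (\<Delta> i)"
  using \<Delta>_step \<Delta>_2 by auto

text \<open>Induction along the tower. The coefficients at stage \<open>i\<close> are only known to
  be algebraic over the previous stage, so their membership may be shown under the assumption that
  this stage already lies in \<open>F\<close>.\<close>

lemma \<Delta>_subset:
  assumes F: "is_subfield F" "K \<subseteq> F" "u 2 \<in> F"
    and U: "\<And>i j. i \<in> {3..p} \<Longrightarrow> i \<le> q \<Longrightarrow> \<Delta> (i - 1) \<subseteq> F \<Longrightarrow> j \<in> coeff_indices i \<Longrightarrow> U i j \<in> F"
    and u: "\<And>i. i \<in> {3..p} \<Longrightarrow> i \<le> q \<Longrightarrow> \<Delta> (i - 1) \<subseteq> F \<Longrightarrow> i \<in> T \<Longrightarrow> u i \<in> F"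
    and i: "2 \<le> i" "i \<le> q" "i = 2 \<or> i \<le> p"
  shows "\<Delta> i \<subseteq> F"
  using i
proof (induction i rule: nat_induct_at_least)
  case base
  show ?case unfolding \<Delta>_2 using F by (intro adjoin_least) auto
next
  case (Suc i)
  hence i: "Suc i \<in> {3..p}" "Suc i \<le> q" "\<Delta> (Suc i - 1) \<subseteq> F" by auto
  show ?case unfolding \<Delta>_step[OF i(1)]
    using i U[OF i] u[OF i] by (intro adjoin_least F) (auto split: if_splits)
qed

lemma \<Delta>_subset_coeff_field:
  assumes "i = 2 \<or> i \<in> {3..p}"
  shows "\<Delta> i \<subseteq> coeff_field"
proof (rule \<Delta>_subset[where q = i])
  show "u i \<in> coeff_field" if "i \<in> {3..p}" "i \<in> T" for i using round_situation2[OF that] by metis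
qed (use assms is_subfield_coeff_field constants_subset_coeff_field u2 coefficients in auto)

lemma \<Delta>_mono:
  assumes "2 \<le> i" "i \<le> l" "l \<le> p"
  shows "\<Delta> i \<subseteq> \<Delta> l"
  using assms(2,3)
proof (induction l rule: dec_induct)
  case (step l)
  have "\<Delta> (Suc l) = adjoin (\<Delta> l) (U (Suc l) ` coeff_indices (Suc l) \<union> (if Suc l \<in> T then {u (Suc l)} else {}))"
    using \<Delta>_step[of "Suc l"] step assms(1) by simp
  hence "\<Delta> l \<subseteq> \<Delta> (Suc l)" by (auto intro: adjoin_base)
  thus ?case using step by auto
qed simp

text \<open>The first two variables are unchanged by the round and give \<open>u 2\<close>. Going up
  the tower, the coefficients are algebraic over a stage already inside \<open>E\<close>, hence
  simple roots over \<open>E\<close>, and \<open>root\<close> puts them into \<open>E\<close>. Each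
  \<open>u i\<close> is recovered from \<open>Y' i\<close>, and finally each \<open>Y i\<close> from
  its remainder.\<close>

lemma round_backward:
  assumes char0: "\<And>k. k > 0 \<Longrightarrow> of_nat k \<noteq> (0 :: 'c)"
    and E: "is_subfield E" "K \<subseteq> E" and p: "2 \<le> p"
    and Y': "\<And>i. i \<in> {1..p} \<Longrightarrow> Y' i \<in> E"
    and root: "\<And>i j. i \<in> {3..p} \<Longrightarrow> j \<in> coeff_indices i \<Longrightarrow> simple_root_over E (U i j) \<Longrightarrow> U i j \<in> E"
  shows "i \<in> {2..p} \<Longrightarrow> \<Delta> i \<subseteq> E" "i \<in> {1..p} \<Longrightarrow> Y i \<in> E"
    "i \<in> {3..p} \<Longrightarrow> j \<in> coeff_indices i \<Longrightarrow> simple_root_over E (U i j)"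
proof -
  have Y'_eq: "Y' i = Y i" if "i \<notin> {3..p}" for i
    using that by (rule round_facts)
  have Y12: "Y 1 \<in> E" "Y 2 \<in> E" using Y'[of 1] Y'[of 2] Y'_eq[of 1] Y'_eq[of 2] p by auto
  have U_root: "simple_root_over E (U i j)" if "i \<in> {3..p}" "j \<in> coeff_indices i" "\<Delta> (i - 1) \<subseteq> E" for i j
  proof (rule algebraic_imp_simple_root[OF char0 is_subfield_coeff_field trivially_valued_coeff_field])
    have "i - 1 = 2 \<or> i - 1 \<in> {3..p}" using that by auto
    thus "is_subfield (\<Delta> (i - 1))" "\<Delta> (i - 1) \<subseteq> coeff_field"
      using is_subfield_\<Delta> \<Delta>_subset_coeff_field by blast+
  qed (use that coefficients in auto)
  have rem: "remainder (Y i) (Y 1) (U i) (s i) \<in> E" if i: "i \<in> {3..p}" "i \<in> T" for i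
  proof -
    obtain r where "Y' i = remainder (Y i) (Y 1) (U i) (s i) / Y 1 ^ (r - 1)"
      using round_situation2[OF i] by metis
    hence "remainder (Y i) (Y 1) (U i) (s i) = Y' i * Y 1 ^ (r - 1)"
      using Y1_nonzero by simp
    thus ?thesis using Y'[of i] i Y12 is_subfieldD(4)[OF E(1)] subfield_power[OF E(1)] by simp
  qed
  have u_mem: "u i \<in> E" if i: "i \<in> {3..p}" "i \<in> T" for i
  proof -
    obtain r where "remainder (Y i) (Y 1) (U i) (s i) = u i * Y 1 ^ r"
      using round_situation2[OF i] by metis
    hence "u i = remainder (Y i) (Y 1) (U i) (s i) / Y 1 ^ r" using Y1_nonzero by simp
    thus ?thesis using rem[OF i] Y12 is_subfieldD(8)[OF E(1)] subfield_power[OF E(1)] by simp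
  qed
  have \<Delta>E: "\<Delta> i \<subseteq> E" if "i \<in> {2..p}" for i
  proof (rule \<Delta>_subset[where q = p])
    show "u 2 \<in> E" unfolding u2(1) using Y12 by (intro is_subfieldD(8)[OF E(1)])
    show "U i j \<in> E" if "i \<in> {3..p}" "\<Delta> (i - 1) \<subseteq> E" "j \<in> coeff_indices i" for i j
      using that by (intro root U_root)
    show "u i \<in> E" if "i \<in> {3..p}" "i \<in> T" for i using that by (rule u_mem)
  qed (use that E in auto)
  have roots: "simple_root_over E (U i j)" if "i \<in> {3..p}" "j \<in> coeff_indices i" for i j
    using that by (intro U_root \<Delta>E) auto
  thus "i \<in> {3..p} \<Longrightarrow> j \<in> coeff_indices i \<Longrightarrow> simple_root_over E (U i j)" .
  show "i \<in> {2..p} \<Longrightarrow> \<Delta> i \<subseteq> E" by (rule \<Delta>E)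
  show "Y i \<in> E" if i: "i \<in> {1..p}"
  proof (cases "i \<in> {3..p} \<and> i \<in> T")
    case True
    show ?thesis
    proof (rule subfield_of_remainder[OF E(1) rem Y12(1)])
      show "U i j \<in> E" if "j \<in> {1..s i}" for j
      proof -
        have "j \<in> coeff_indices i" using True that by (simp add: coeff_indices_def)
        thus ?thesis using True by (intro root roots) blast+
      qed
    qed (use True in blast)+
  next
    case False
    hence "Y' i = Y i" using Y'_eq round_situation3(3) by blast
    thus ?thesis using Y'[OF i] by simp
  qed
qed

text \<open>In situation (2) the variable is a polynomial in \<open>Y 1\<close> over
  \<open>D\<close>; in situation (3) it is the limit of its partial sums, which converge since
  \<open>Y 1\<close> has value 1.\<close>

lemma Y_in_laurent_field:
  assumes w1: "w (Y 1) = 1" and D: "is_subfield D" "D \<subseteq> coeff_field" "u 2 \<in> D"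
    and U: "\<And>i j. i \<in> {3..p} \<Longrightarrow> j \<in> coeff_indices i \<Longrightarrow> U i j \<in> D"
    and u: "\<And>i. i \<in> {3..p} \<Longrightarrow> i \<in> T \<Longrightarrow> u i \<in> D"
    and i: "i \<in> {1..p}"
  shows "Y i \<in> laurent_field D (Y 1)"
proof -
  have triv: "trivially_valued D" using trivially_valued_mono[OF trivially_valued_coeff_field D(2)] .
  note lf = D(1) triv Y1_nonzero w1
  note E = is_subfield_laurent_field[OF lf]
  have DE: "D \<subseteq> laurent_field D (Y 1)" and t: "Y 1 \<in> laurent_field D (Y 1)"
    by (rule laurent_field_base[OF lf], rule laurent_field_gen[OF lf])
  consider "i = 1" | "i = 2" | "i \<in> {3..p}" "i \<in> T" | "i \<in> {3..p}" "i \<notin> T" using i by force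
  thus ?thesis
  proof cases
    case 2
    have "Y 2 = u 2 * Y 1" using Y1_nonzero by (simp add: u2(1))
    thus ?thesis using 2 is_subfieldD(4)[OF E] D(3) DE t by auto
  next
    case 3
    obtain r where r: "remainder (Y i) (Y 1) (U i) (s i) = u i * Y 1 ^ r"
      using round_situation2[OF 3] by metis
    show ?thesis
    proof (rule subfield_of_remainder[OF E _ t])
      show "remainder (Y i) (Y 1) (U i) (s i) \<in> laurent_field D (Y 1)"
        unfolding r using u[OF 3] DE t by (intro is_subfieldD(4)[OF E] subfield_power[OF E]) auto
      show "U i j \<in> laurent_field D (Y 1)" if "j \<in> {1..s i}" for j
        using U[of i j] 3 that DE by (auto simp: coeff_indices_def)
    qed
  next
    case 4
    show ?thesis
    proof (rule val_closedD[OF val_closed_laurent_field[OF lf]])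
      fix N
      define q where "q = (\<Sum>j=1..nat N. U i j * Y 1 ^ j)"
      have "q \<in> laurent_field D (Y 1)"
        unfolding q_def using U[of i] 4 DE t
        by (intro subfield_sum[OF E] is_subfieldD(4)[OF E] subfield_power[OF E]) (auto simp: coeff_indices_def)
      have "value_ge 0 (remainder (Y i) (Y 1) (U i) (nat N) / Y 1 ^ Suc (nat N))"
      proof -
        \<comment> \<open>Integrality of the quotient at index \<open>Suc (nat N)\<close> concerns
          the remainder after \<open>nat N\<close> terms; it bounds the value of that remainder
          below by \<open>nat N + 1\<close>.\<close>
        have "Suc (nat N) \<in> {1..Suc (nat N)}" by simp
        hence "remainder (Y i) (Y 1) (U i) (Suc (nat N) - 1) / Y 1 ^ Suc (nat N) \<in> valuation_ring w"
          using round_situation3(1)[OF 4, of "Suc (nat N)"] unfolding expands_def by blast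
        thus ?thesis by (simp only: valuation_ring_iff diff_Suc_1)
      qed
      moreover have "value_ge (int (Suc (nat N))) (Y 1 ^ Suc (nat N))"
        using Y1_nonzero w1 by (simp add: value_ge_def w_power del: power_Suc of_nat_Suc)
      ultimately have "value_ge (int (Suc (nat N)))
          (remainder (Y i) (Y 1) (U i) (nat N) / Y 1 ^ Suc (nat N) * Y 1 ^ Suc (nat N))"
        by (rule value_ge_mult_left)
      hence "value_ge (int (Suc (nat N))) (Y i - q)"
        using Y1_nonzero by (simp add: remainder_def q_def)
      hence "value_ge N (Y i - q)" by (rule value_ge_mono) simp
      thus "\<exists>y\<in>laurent_field D (Y 1). value_ge N (Y i - y)"
        using \<open>q \<in> laurent_field D (Y 1)\<close> by blast
    qed
  qed (use t in auto)
qed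

end

section \<open>Running the construction backwards\<close>

context valued_field
begin

text \<open>Values say nothing at 0, and undoing a monoidal step multiplies back a denominator.
  Quotients and interchanges preserve being nonzero, and every remainder that becomes a variable is
  required to be nonzero.\<close>

lemma construction_nonzero:
  assumes "construction w K n Z Y C" and Z: "\<And>i. i \<in> {1..n} \<Longrightarrow> Z i \<noteq> 0" and K: "is_subfield K"
  shows "i \<in> {1..n} \<Longrightarrow> Y i \<noteq> 0"
  using assms(1)
proof (induction arbitrary: i rule: construction.induct)
  case start
  thus ?case by (rule Z)
next
  case (monoidal Y C i j l)
  thus ?case using monoidal.IH[of i] monoidal.IH[of j] monoidal.IH[of l] by simp
next
  case (interchange Y C i j l)
  thus ?case using interchange.IH[of i] interchange.IH[of j] interchange.IH[of l] by simp
next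
  case (constant_coefficients Y C i j s a z l)
  show ?case
    using constant_coefficients.IH[of l] constant_coefficients.prems \<open>z \<noteq> 0\<close> by simp
next
  case (restart Y C i \<sigma> T s U u \<Delta> Y' l)
  interpret fixed_round w K \<sigma> n "i - 1" Y T s U u \<Delta> Y'
    by unfold_locales
       (use restart.hyps restart.IH K construction_round_section[OF restart.hyps(3)] in auto)
  consider "l = i" | "l \<noteq> i" "l \<in> {3..i - 1}" "l \<in> T" | "l \<noteq> i" "l \<notin> {3..i - 1} \<or> l \<notin> T" by blast
  thus ?case
  proof cases
    case 1
    thus ?thesis using restart by (simp add: situation1_def)
  next
    case 2
    obtain r where "remainder (Y l) (Y 1) (U l) (s l) \<noteq> 0"
      "Y' l = remainder (Y l) (Y 1) (U l) (s l) / Y 1 ^ (r - 1)"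
      using round_situation2[OF 2(2,3)] by metis
    thus ?thesis using 2(1) Y1_nonzero by simp
  next
    case 3
    hence "Y' l = Y l" using round_situation3(3) round_facts(6) by blast
    thus ?thesis using 3(1) nonzero restart.prems by simp
  qed
qed

text \<open>The last step is undone first: old variables are polynomials in new ones with
  coefficients in \<open>K\<close> or \<open>C\<close>. For a closed round, the later variables in
  \<open>E\<close> make its coefficients simple roots over \<open>E\<close>; the assumption on
  \<open>C\<close> then moves them into \<open>E\<close>, which gives the earlier variables. That
  assumption is conditional so that the simple root property can itself be used to verify
  membership.\<close>

lemma construction_backward:
  assumes "construction w K n Z Y C" and Z: "\<And>i. i \<in> {1..n} \<Longrightarrow> Z i \<noteq> 0"
    and K: "is_subfield K" and char0: "\<And>k. k > 0 \<Longrightarrow> of_nat k \<noteq> (0 :: 'c)"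
    and E: "is_subfield E" "K \<subseteq> E"
    and "\<And>i. i \<in> {1..n} \<Longrightarrow> Y i \<in> E" "\<And>c. c \<in> C \<Longrightarrow> simple_root_over E c \<Longrightarrow> c \<in> E"
  shows "(\<forall>i\<in>{1..n}. Z i \<in> E) \<and> (\<forall>c\<in>C. simple_root_over E c)"
  using assms(1,7,8)
proof (induction rule: construction.induct)
  case (monoidal Y C i j)
  have nz: "Y j \<noteq> 0" using construction_nonzero[OF monoidal(1) Z K] monoidal by blast
  \<comment> \<open>The two values differ, so \<open>Y j\<close> survives the step and can be
    multiplied back.\<close>
  have "i \<noteq> j" using monoidal by auto
  have "Y l \<in> E" if l: "l \<in> {1..n}" for l
  proof (cases "l = i")
    case True
    have "Y i / Y j * Y j \<in> E"
      using monoidal.prems(1)[of i] monoidal.prems(1)[of j] monoidal.hyps \<open>i \<noteq> j\<close>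
      by (intro is_subfieldD(4)[OF E(1)]) auto
    thus ?thesis using True nz by simp
  qed (use monoidal.prems(1)[OF l] in simp)
  thus ?case using monoidal by blast
next
  case (interchange Y C i j)
  have "Y l \<in> E" if l: "l \<in> {1..n}" for l
    using interchange.prems(1)[OF l] interchange.prems(1)[of i] interchange.prems(1)[of j]
      interchange.hyps by (auto split: if_splits)
  thus ?case using interchange by blast
next
  case (constant_coefficients Y C i j s a z)
  have "Y l \<in> E" if l: "l \<in> {1..n}" for l
  proof (cases "l = i")
    case True
    show ?thesis
      unfolding True
    proof (rule subfield_of_remainder[OF E(1)])
      show "remainder (Y i) (Y j) a s \<in> E"
        using constant_coefficients.prems(1)[of i] \<open>i \<in> {1..n}\<close> \<open>z = _\<close> by simp
      show "Y j \<in> E"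
        using constant_coefficients.prems(1)[of j] \<open>j \<in> {1..n}\<close> \<open>i \<noteq> j\<close> by simp
      show "a k \<in> E" if "k \<in> {1..s}" for k
        using constant_coefficients.hyps that E(2) by blast
    qed
  qed (use constant_coefficients.prems(1)[OF l] in simp)
  thus ?case using constant_coefficients by blast
next
  case (restart Y C i \<sigma> T s U u \<Delta> Y')
  interpret fixed_round w K \<sigma> n "i - 1" Y T s U u \<Delta> Y'
    by unfold_locales
       (use restart.hyps K construction_nonzero[OF restart.hyps(1) Z K]
          construction_round_section[OF restart.hyps(3)] in auto)
  let ?C = "(\<Union>l\<in>{3..<i}. if l \<in> T then U l ` {1..s l} else U l ` {1..})"
  have C_eq: "?C = (\<Union>l\<in>{3..i - 1}. U l ` coeff_indices l)"
    using restart.hyps by (intro SUP_cong) (auto simp: coeff_indices_def)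
  have Y'E: "Y' l \<in> E" if "l \<in> {1..n}" "l \<noteq> i" for l
    using restart.prems(1)[OF that(1)] that(2) by simp
  have C_new: "c \<in> E" if "c \<in> ?C \<union> U i ` {1..s i}" "simple_root_over E c" for c
    using restart.prems(2)[of c] that by blast
  have root: "U l j \<in> E" if "l \<in> {3..i - 1}" "j \<in> coeff_indices l" "simple_root_over E (U l j)" for l j
  proof (rule C_new[OF _ that(3)])
    show "U l j \<in> ?C \<union> U i ` {1..s i}" unfolding C_eq using that by blast
  qed
  have i: "2 \<le> i - 1" "i - 1 \<in> {2..i - 1}" using restart.hyps by auto
  have Y'p: "\<And>l. l \<in> {1..i - 1} \<Longrightarrow> Y' l \<in> E" using restart.hyps by (intro Y'E) auto
  have \<Delta>E: "\<Delta> (i - 1) \<subseteq> E"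
    by (rule round_backward(1)[OF _ E i(1) _ _ i(2)]) (fact char0 Y'p root)+
  have YE: "Y l \<in> E" if "l \<in> {1..i - 1}" for l
    by (rule round_backward(2)[OF _ E i(1) _ _ that]) (fact char0 Y'p root)+
  have roots: "simple_root_over E (U l j)" if "l \<in> {3..i - 1}" "j \<in> coeff_indices l" for l j
    by (rule round_backward(3)[OF _ E i(1) _ _ that]) (fact char0 Y'p root)+
  \<comment> \<open>The variable that closed the round in situation (1) has coefficients algebraic
    over the last stage of the tower, which is now known to lie in \<open>E\<close>.\<close>
  have roots_i: "simple_root_over E (U i j)" if j: "j \<in> {1..s i}" for j
  proof (rule algebraic_imp_simple_root[OF char0 is_subfield_coeff_field trivially_valued_coeff_field _ _ _ \<Delta>E])
    have "i - 1 = 2 \<or> i - 1 \<in> {3..i - 1}" using restart.hyps by auto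
    thus "is_subfield (\<Delta> (i - 1))" "\<Delta> (i - 1) \<subseteq> coeff_field"
      using is_subfield_\<Delta> \<Delta>_subset_coeff_field by blast+
    show "U i j \<in> coeff_field" "algebraic_over (\<Delta> (i - 1)) (U i j)"
      using restart.hyps j expands_mem_coeff_field unfolding situation1_def by blast+
  qed
  have "Y l \<in> E" if l: "l \<in> {1..n}" for l
  proof -
    consider "l = i" | "l \<in> {1..i - 1}" | "l > i" using l by force
    thus ?thesis
    proof cases
      case 1
      show ?thesis unfolding 1
      proof (rule subfield_of_remainder[OF E(1)])
        show "remainder (Y i) (Y 1) (U i) (s i) \<in> E"
          using restart.prems(1)[OF l] 1 by simp
        show "Y 1 \<in> E" using YE[of 1] i by simp
        show "U i j \<in> E" if "j \<in> {1..s i}" for j using that roots_i by (intro C_new) auto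
      qed
    next
      case 3
      hence "Y' l = Y l" by (intro round_facts) auto
      thus ?thesis using Y'E[OF l] 3 by simp
    qed (use YE in blast)
  qed
  hence IH: "(\<forall>i\<in>{1..n}. Z i \<in> E) \<and> (\<forall>c\<in>C. simple_root_over E c)"
    using restart.IH restart.prems(2) by blast
  moreover have "simple_root_over E c" if "c \<in> ?C \<union> U i ` {1..s i}" for c
    using that roots roots_i unfolding C_eq by blast
  ultimately show ?case by blast
qed auto

end


section \<open>The residue field\<close>

lemma (in valued_field_section) is_subfield_algebraic_closure:
  assumes "is_subfield F"
  shows "is_subfield {x \<in> coeff_field. algebraic_over F x}"
  using is_subfield_coeff_field is_subfield_algebraics[OF assms] by (simp add: is_subfield_def)

context fixed_round
begin

text \<open>Each new \<open>u i\<close> is transcendental over a stage that contains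
  \<open>K\<close> and all previous ones. This gives both independence and distinctness, and so the
  cardinality.\<close>

lemma transcendental_chain:
  assumes u2: "\<not> algebraic_over K (u 2)" and i: "i = 2 \<or> i \<in> {3..p}" and T: "{3..i} \<subseteq> T"
  shows "algebraically_independent K (u ` {2..i})" "card (u ` {2..i}) = i - 1" "u ` {2..i} \<subseteq> \<Delta> i"
proof -
  have "2 \<le> i" using i by auto
  hence "(i = 2 \<or> i \<le> p) \<longrightarrow> {3..i} \<subseteq> T \<longrightarrow> algebraically_independent K (u ` {2..i}) \<and>
      card (u ` {2..i}) = i - 1 \<and> u ` {2..i} \<subseteq> \<Delta> i"
  proof (induction i rule: nat_induct_at_least)
    case base
    have "adjoin K {} \<subseteq> K" by (rule adjoin_least[OF K]) auto
    hence "\<not> algebraic_over (adjoin K {}) (u 2)" using u2 algebraic_over_mono by blast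
    hence "algebraically_independent K {u 2}"
      by (rule algebraically_independent_insert[OF K algebraically_independent_empty])
    thus ?case by (simp add: \<Delta>_2 adjoin_gen)
  next
    case (Suc i)
    show ?case
    proof (intro impI)
      assume p: "Suc i = 2 \<or> Suc i \<le> p" and T: "{3..Suc i} \<subseteq> T"
      have Si: "Suc i \<in> {3..p}" "Suc i \<in> T" using p T Suc.hyps by auto
      have IH: "algebraically_independent K (u ` {2..i})" "card (u ` {2..i}) = i - 1" "u ` {2..i} \<subseteq> \<Delta> i"
        using Suc p T by auto
      have "i = 2 \<or> i \<in> {3..p}" using Si by auto
      hence \<Delta>: "is_subfield (\<Delta> i)" by (rule is_subfield_\<Delta>)
      have "K \<subseteq> \<Delta> 2" unfolding \<Delta>_2 by (auto intro: adjoin_base)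
      also have "\<Delta> 2 \<subseteq> \<Delta> i" using Si by (intro \<Delta>_mono) auto
      finally have "adjoin K (u ` {2..i}) \<subseteq> \<Delta> i" using IH(3) by (intro adjoin_least \<Delta>)
      moreover have trans: "\<not> algebraic_over (\<Delta> i) (u (Suc i))"
        using round_situation2[OF Si] by (metis diff_Suc_1)
      ultimately have "\<not> algebraic_over (adjoin K (u ` {2..i})) (u (Suc i))"
        using algebraic_over_mono by blast
      hence "algebraically_independent K (insert (u (Suc i)) (u ` {2..i}))"
        by (rule algebraically_independent_insert[OF K IH(1)])
      moreover have "u (Suc i) \<notin> u ` {2..i}"
        using trans IH(3) algebraic_over_self[OF \<Delta>] by blast
      moreover have "{2..Suc i} = insert (Suc i) {2..i}" using Suc.hyps by auto
      moreover have "u (Suc i) \<in> \<Delta> (Suc i)"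
        using \<Delta>_step[OF Si(1)] Si(2) by (simp add: adjoin_gen)
      moreover have "\<Delta> i \<subseteq> \<Delta> (Suc i)" using Si by (intro \<Delta>_mono) auto
      ultimately show "algebraically_independent K (u ` {2..Suc i}) \<and>
          card (u ` {2..Suc i}) = Suc i - 1 \<and> u ` {2..Suc i} \<subseteq> \<Delta> (Suc i)"
        using IH Suc.hyps by auto
    qed
  qed
  thus "algebraically_independent K (u ` {2..i})" "card (u ` {2..i}) = i - 1" "u ` {2..i} \<subseteq> \<Delta> i"
    using i T by auto
qed

end

text \<open>The coefficients in \<open>C\<close> come from closed rounds, possibly with other
  sections. The original variables involve them, so their residues, transported by the final
  \<sigma>, are among the generators of \<open>\<Delta>n\<close>.\<close>

theorem theorem14:
  fixes v :: "('k::{alg_closed_field, field_char_0}, 'n::finite) mps fract \<Rightarrow> int"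
    and \<iota> :: "('k, 'n) mps fract \<Rightarrow> 'c::field" and w :: "'c \<Rightarrow> int"
    and K :: "'c set" and n m :: nat and e :: "nat \<Rightarrow> 'n"
    and Y Y' :: "nat \<Rightarrow> 'c" and C :: "'c set" and \<sigma> :: "'c set \<Rightarrow> 'c"
    and s :: "nat \<Rightarrow> nat" and U :: "nat \<Rightarrow> nat \<Rightarrow> 'c" and u :: "nat \<Rightarrow> 'c"
    and \<Delta> :: "nat \<Rightarrow> 'c set" and \<Delta>n :: "'c set"
  assumes "n > 2" and "bij_betw e {1..n} (UNIV :: 'n set)"
    and "centered_valuation v"
    and "is_completion v \<iota> w"
    and "K = range (\<lambda>c. \<iota> (to_fract (mps_const c)))"
    and "construction w K n (\<lambda>i. \<iota> (to_fract (mps_var (e i)))) Y C"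
    and "w (Y 1) = 1"
    and "2 \<le> m" and "m \<le> n"
    and "construction_round w K n Y \<sigma> n {3..m} s U u \<Delta> Y'"
    and "\<Delta>n = adjoin (adjoin K ({u 2} \<union> (\<Union>i\<in>{3..m}. U i ` {1..s i} \<union> {u i})))
                 ((\<Union>i\<in>{m+1..n}. U i ` {1..}) \<union> (\<lambda>c. \<sigma> (residue w c)) ` C)"
  shows "residue_field_iso v (\<lambda>A. \<sigma> (residue_map \<iota> w A)) \<Delta>n \<and>
         has_transcendence_degree K \<Delta>n (m - 1)"
proof -
  interpret power_series_completion v \<iota> w
    using assms(3,4) by unfold_locales
  have K_eq: "K = constants" using assms(5) by (simp add: constants_def)
  have subK: "is_subfield K" unfolding K_eq by (rule is_subfield_constants)
  have vars: "\<iota> (to_fract (mps_var (e i))) \<noteq> 0" for i by (rule var_nonzero)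
  have Y_nz: "Y i \<noteq> 0" if "i \<in> {1..n}" for i
    using construction_nonzero[OF assms(6) vars subK that] .
  interpret fixed_round w K \<sigma> n n Y "{3..m}" s U u \<Delta> Y'
    using assms(1,10) construction_round_section[OF assms(10)] subK Y_nz by unfold_locales auto
  \<comment> \<open>To be used with \<open>E\<close> the Laurent field over \<open>N\<close>, and
    then over \<open>\<Delta>n\<close>.\<close>
  have backward: "(\<forall>i\<in>{1..n}. \<iota> (to_fract (mps_var (e i))) \<in> E) \<and> (\<forall>c\<in>C. simple_root_over E c)"
    if "is_subfield E" "K \<subseteq> E" "\<And>i. i \<in> {1..n} \<Longrightarrow> Y i \<in> E"
      "\<And>c. c \<in> C \<Longrightarrow> simple_root_over E c \<Longrightarrow> c \<in> E" for E
    by (rule construction_backward[OF assms(6) vars subK]) (fact that of_nat_nonzero)+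
  have u_S: "u i \<in> coeff_field" if "i \<in> {2..m}" for i
  proof (cases "i = 2")
    case False
    hence "i \<in> {3..n}" "i \<in> {3..m}" using that assms(9) by auto
    thus ?thesis using round_situation2 by metis
  qed (use u2 in simp)
  have J_eq: "coeff_indices i = (if i \<le> m then {1..s i} else {1..})" if "i \<in> {3..n}" for i
    using that by (simp add: coeff_indices_def)

  \<comment> \<open>The relative algebraic closure of \<open>K(u_2, ..., u_m)\<close>\<close>
  define B where "B = u ` {2..m}"
  define N where "N = {x \<in> coeff_field. algebraic_over (adjoin K B) x}"
  have N: "is_subfield N" "N \<subseteq> coeff_field"
    unfolding N_def by (rule is_subfield_algebraic_closure[OF is_subfield_adjoin]) auto
  have B_S: "B \<subseteq> coeff_field" unfolding B_def using u_S by auto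
  have "adjoin K B \<subseteq> coeff_field" by (rule adjoin_least[OF is_subfield_coeff_field constants_subset_coeff_field B_S])
  hence base_N: "adjoin K B \<subseteq> N"
    unfolding N_def using algebraic_over_self[OF is_subfield_adjoin] by blast
  hence K_N: "K \<subseteq> N" and B_N: "B \<subseteq> N" using adjoin_base[of _ K B] adjoin_gen[of _ B K] by auto
  have N_closed: "x \<in> N" if "x \<in> coeff_field" "algebraic_over N x" for x
  proof -
    have "algebraic_over {y. algebraic_over (adjoin K B) y} x"
      using that(2) by (rule algebraic_over_mono) (auto simp: N_def)
    thus ?thesis using that(1) algebraic_over_trans[OF is_subfield_adjoin] by (auto simp: N_def)
  qed
  have U_N': "U i j \<in> N" if "i \<in> {3..n}" "\<Delta> (i - 1) \<subseteq> N" "j \<in> coeff_indices i" for i j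
    using coefficients[OF that(1,3)] algebraic_over_mono[OF _ that(2)] N_closed by blast
  have u_N: "u i \<in> N" if "i \<in> {2..m}" for i using B_N that by (auto simp: B_def)
  have \<Delta>_N: "\<Delta> i \<subseteq> N" if "i \<in> {2..n}" for i
    by (rule \<Delta>_subset[where q = i]) (use N(1) K_N U_N' u_N that assms(8) in auto)
  have U_N: "U i j \<in> N" if "i \<in> {3..n}" "j \<in> coeff_indices i" for i j
    using that by (intro U_N' \<Delta>_N) auto

  \<comment> \<open>Laurent expansions of the final variables and residues of closed rounds\<close>
  have Y_laurent: "Y i \<in> laurent_field D (Y 1)"
    if "is_subfield D" "D \<subseteq> coeff_field" "\<And>i. i \<in> {2..m} \<Longrightarrow> u i \<in> D"
      "\<And>i j. i \<in> {3..n} \<Longrightarrow> j \<in> coeff_indices i \<Longrightarrow> U i j \<in> D" "i \<in> {1..n}" for D i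
    using that assms(8) by (intro Y_in_laurent_field[OF assms(7)]) auto

  have triv: "trivially_valued D" if "D \<subseteq> coeff_field" for D
    using trivially_valued_mono[OF trivially_valued_coeff_field that] .
  have C_N: "value_ge 0 c \<and> \<sigma> (residue w c) \<in> N" if c: "c \<in> C" for c
  proof -
    note lf = N(1) triv[OF N(2)] Y1_nonzero assms(7)
    let ?E = "laurent_field N (Y 1)"
    \<comment> \<open>The residue of a simple root over the Laurent field is algebraic over
      \<open>N\<close>, hence in \<open>N\<close>. The starting point for Newton approximation is
      thus available without further assumptions on \<open>c\<close>.\<close>
    have res: "\<sigma> (residue w c) \<in> N" if "simple_root_over ?E c" for c
    proof (rule N_closed)
      show "\<sigma> (residue w c) \<in> coeff_field"
        using that by (intro section_residue) (simp add: simple_root_over_def)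
      show "algebraic_over N (\<sigma> (residue w c))"
        by (rule simple_root_algebraic_residue[OF laurent_field_residue[OF lf] N(2) that])
    qed
    have "simple_root_over ?E c"
    proof (rule backward[THEN conjunct2, THEN bspec, OF is_subfield_laurent_field[OF lf] _ _ _ c])
      show "K \<subseteq> ?E" using K_N laurent_field_base[OF lf] by blast
      show "Y i \<in> ?E" if "i \<in> {1..n}" for i
        using that U_N u_N by (intro Y_laurent N)
      show "c \<in> ?E" if "simple_root_over ?E c" for c
      proof (rule newton_simple_root[OF is_subfield_laurent_field[OF lf] val_closed_laurent_field[OF lf] that])
        show "\<sigma> (residue w c) \<in> ?E" using res[OF that] laurent_field_base[OF lf] by blast
        show "value_ge 1 (c - \<sigma> (residue w c))"
          using that by (intro section_residue) (simp add: simple_root_over_def)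
      qed
    qed
    thus ?thesis using res by (simp add: simple_root_over_def)
  qed

  \<comment> \<open>The field \<open>\<Delta>n\<close> inside the relative algebraic closure\<close>
  have gens: "u i \<in> \<Delta>n" if "i \<in> {2..m}" for i
  proof -
    have "u i \<in> {u 2} \<union> (\<Union>i\<in>{3..m}. U i ` {1..s i} \<union> {u i})"
      using that by (cases "i = 2") auto
    thus ?thesis unfolding assms(11) by (intro adjoin_base adjoin_gen)
  qed
  have U_gens: "U i j \<in> \<Delta>n" if "i \<in> {3..n}" "j \<in> coeff_indices i" for i j
  proof (cases "i \<le> m")
    case True
    hence "i \<in> {3..m}" "U i j \<in> U i ` {1..s i}" using that J_eq[OF that(1)] by simp_all
    hence "U i j \<in> {u 2} \<union> (\<Union>i\<in>{3..m}. U i ` {1..s i} \<union> {u i})" by blast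
    thus ?thesis unfolding assms(11) by (intro adjoin_base adjoin_gen)
  next
    case False
    hence "i \<in> {m+1..n}" "U i j \<in> U i ` {1..}" using that J_eq[OF that(1)] by simp_all
    hence "U i j \<in> (\<Union>i\<in>{m+1..n}. U i ` {1..}) \<union> (\<lambda>c. \<sigma> (residue w c)) ` C" by blast
    thus ?thesis unfolding assms(11) by (rule adjoin_gen)
  qed
  have C_gens: "\<sigma> (residue w c) \<in> \<Delta>n" if "c \<in> C" for c
    unfolding assms(11) using that by (intro adjoin_gen) auto
  have sub: "is_subfield \<Delta>n" unfolding assms(11) by simp
  have K_\<Delta>n: "K \<subseteq> \<Delta>n" unfolding assms(11) using adjoin_base by blast
  have \<Delta>n_N: "\<Delta>n \<subseteq> N"
    unfolding assms(11)
  proof (intro adjoin_least N(1) K_N)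
    have "U i ` {1..s i} \<subseteq> N" "u i \<in> N" if "i \<in> {3..m}" for i
      using U_N[of i] u_N[of i] J_eq[of i] that assms(9) by auto
    moreover have "u 2 \<in> N" using u_N[of 2] assms(8) by simp
    ultimately show "{u 2} \<union> (\<Union>i\<in>{3..m}. U i ` {1..s i} \<union> {u i}) \<subseteq> N" by blast
    have "U i ` {1..} \<subseteq> N" if "i \<in> {m+1..n}" for i
      using U_N[of i] J_eq[of i] that assms(8) by auto
    thus "(\<Union>i\<in>{m+1..n}. U i ` {1..}) \<union> (\<lambda>c. \<sigma> (residue w c)) ` C \<subseteq> N"
      using C_N by blast
  qed
  have \<Delta>n_S: "\<Delta>n \<subseteq> coeff_field" using \<Delta>n_N N(2) by blast

  \<comment> \<open>The residue field equals \<open>\<Delta>n\<close>\<close>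
  note lf = sub triv[OF \<Delta>n_S] Y1_nonzero assms(7)
  let ?E = "laurent_field \<Delta>n (Y 1)"
  have "\<forall>i\<in>{1..n}. \<iota> (to_fract (mps_var (e i))) \<in> ?E"
  proof (rule backward[THEN conjunct1, OF is_subfield_laurent_field[OF lf]])
    show "K \<subseteq> ?E" using K_\<Delta>n laurent_field_base[OF lf] by blast
    show "Y i \<in> ?E" if "i \<in> {1..n}" for i
      using that gens U_gens \<Delta>n_S sub by (intro Y_laurent)
    \<comment> \<open>Here the residue of \<open>c\<close> lies in \<open>\<Delta>n\<close> because
      it was adjoined; that \<open>c\<close> is integral comes from the first application, with
      \<open>N\<close>.\<close>
    show "c \<in> ?E" if "c \<in> C" "simple_root_over ?E c" for c
    proof (rule newton_simple_root[OF is_subfield_laurent_field[OF lf] val_closed_laurent_field[OF lf] that(2)])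
      show "\<sigma> (residue w c) \<in> ?E" using C_gens[OF that(1)] laurent_field_base[OF lf] by blast
      show "value_ge 1 (c - \<sigma> (residue w c))" using C_N[OF that(1)] by (intro section_residue) simp
    qed
  qed
  moreover have "e ` {1..n} = UNIV" using assms(2) by (simp add: bij_betw_def)
  ultimately have "\<iota> (to_fract (mps_var i)) \<in> ?E" for i by (metis UNIV_I imageE)
  hence "\<iota> x \<in> ?E" for x
    using image_subset_closed_field[OF is_subfield_laurent_field[OF lf] val_closed_laurent_field[OF lf]]
      K_\<Delta>n laurent_field_base[OF lf] K_eq by blast
  hence "residue_field_iso v (\<lambda>A. \<sigma> (residue_map \<iota> w A)) \<Delta>n"
    using section_prop sub \<Delta>n_S laurent_field_residue[OF lf]
    by (intro residue_field_isoI) (auto simp: K_eq coeff_field_def)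

  \<comment> \<open>The transcendence degree\<close>
  moreover have "has_transcendence_degree K \<Delta>n (m - 1)"
    unfolding has_transcendence_degree_def
  proof (intro exI[of _ B] conjI ballI)
    \<comment> \<open>The residue of \<open>Y 2 / Y 1\<close> is not that of a constant. Since
      \<open>K\<close> is algebraically closed in the completion, an element outside
      \<open>K\<close> is already transcendental, which starts the chain.\<close>
    have "u 2 \<notin> K" using round_facts(2,4) by auto
    hence "\<not> algebraic_over K (u 2)" using constants_algebraically_closed by (auto simp: K_eq)
    thus "algebraically_independent K B" "card B = m - 1"
      unfolding B_def using assms(8,9) by (intro transcendental_chain; auto)+
    show "B \<subseteq> \<Delta>n" using gens by (auto simp: B_def)
    show "finite B" by (simp add: B_def)
    show "algebraic_over (adjoin K B) x" if "x \<in> \<Delta>n" for x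
      using that \<Delta>n_N by (auto simp: N_def)
  qed
  ultimately show ?thesis ..
qed

end
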